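(* There is a deterministic algorithm in the congested clique model that, given an undirected graph $G=(V,E)$ on $n$ vertices with weights $w\colon E\to\{1,2,\dots,U\}$ and a parameter $1\le r\le\sqrt{\log n/\log\log n}$, computes a $\log(n)^{O(r^2)}$-approximate spectral sparsifier $H$ for $G$ with $|E(H)|\le O(n\log n\log U)$, in $O(\log n\,\log U\, n^{O(1/r^2)})$ rounds. At the end of the algorithm, $H$ is known to every node.
   Context: Congested clique model: there are $n$ processors (nodes), one per vertex of the input graph, each with a unique $O(\log n)$-bit identifier; computation proceeds in synchronous rounds, and in each round every node may send a (possibly different) message of $O(\log n)$ bits to every other node. Initially each node knows only its incident edges and their weights; complexity is the number of rounds. The Laplacian of a weighted undirected graph $G$ is $L_G=D(G)-A(G)$ with $D(G)$ the diagonal weighted degree matrix and $A(G)$ the weighted adjacency matrix. For $\alpha\ge1$, a subgraph $H\subseteq G$ with weights $w_H\colon E(H)\to\mathbb{R}$ is an $\alpha$-approximate spectral sparsifier for $G$ if $\frac{1}{\alpha}x^TL_Hx\le x^TL_Gx\le\alpha\, x^TL_Hx$ for all $x\in\mathbb{R}^n$. *)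

theory Defs
  imports "HOL-Analysis.Analysis"
begin

section \<open>Weighted graphs and spectral sparsifiers\<close>

definition simple_graph :: "'v set \<Rightarrow> 'v set set \<Rightarrow> bool" where
  "simple_graph V E \<longleftrightarrow> finite V \<and> E \<subseteq> {e. e \<subseteq> V \<and> card e = 2}"

definition weighted_degree :: "'v set set \<Rightarrow> ('v set \<Rightarrow> real) \<Rightarrow> 'v \<Rightarrow> real" where
  "weighted_degree E w u = (\<Sum>e | e \<in> E \<and> u \<in> e. w e)"

definition degree_matrix :: "'v set set \<Rightarrow> ('v set \<Rightarrow> real) \<Rightarrow> 'v \<Rightarrow> 'v \<Rightarrow> real" where
  "degree_matrix E w u v = (if u = v then weighted_degree E w u else 0)"

definition adjacency_matrix :: "'v set set \<Rightarrow> ('v set \<Rightarrow> real) \<Rightarrow> 'v \<Rightarrow> 'v \<Rightarrow> real" where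
  "adjacency_matrix E w u v = (if {u, v} \<in> E then w {u, v} else 0)"

definition laplacian :: "'v set set \<Rightarrow> ('v set \<Rightarrow> real) \<Rightarrow> 'v \<Rightarrow> 'v \<Rightarrow> real" where
  "laplacian E w u v = degree_matrix E w u v - adjacency_matrix E w u v"

text \<open>Matrices and vectors are indexed by the vertex set \<open>V\<close>; for \<open>card V = n\<close> the vectors
  \<open>x\<close>, of which only the values on \<open>V\<close> matter, play the role of the elements of
  \<open>n\<close>-dimensional real space.\<close>

definition quadratic_form :: "'v set \<Rightarrow> ('v \<Rightarrow> 'v \<Rightarrow> real) \<Rightarrow> ('v \<Rightarrow> real) \<Rightarrow> real" where
  "quadratic_form V M x = (\<Sum>u\<in>V. \<Sum>v\<in>V. x u * M u v * x v)"

text \<open>The sparsifier has the same vertex set \<open>V\<close>, edge set \<open>F\<close> and weights \<open>wH\<close>, of which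
  only the values on \<open>F\<close> matter.\<close>

definition spectral_sparsifier ::
  "real \<Rightarrow> 'v set \<Rightarrow> 'v set set \<Rightarrow> ('v set \<Rightarrow> real) \<Rightarrow> 'v set set \<Rightarrow> ('v set \<Rightarrow> real) \<Rightarrow> bool" where
  "spectral_sparsifier \<alpha> V E w F wH \<longleftrightarrow> 1 \<le> \<alpha> \<and> F \<subseteq> E \<and>
     (\<forall>x. 1 / \<alpha> * quadratic_form V (laplacian F wH) x \<le> quadratic_form V (laplacian E w) x \<and>
          quadratic_form V (laplacian E w) x \<le> \<alpha> * quadratic_form V (laplacian F wH) x)"

section \<open>The congested clique\<close>

text \<open>Nodes are natural numbers, which serve as their identifiers. The \<open>i\<close>-th inbox of a node
  records which message it received in round \<open>i\<close> from each identifier, with \<open>None\<close> for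
  identifiers that do not belong to another node. Hence the set of identifiers in
  use need not be known in advance, but is known to every node after the first round.\<close>

type_synonym message = "bool list"
type_synonym inbox = "nat \<Rightarrow> message option"

text \<open>A deterministic algorithm: the same program runs on all nodes, and everything a node does
  is a function of its initial knowledge and of the inboxes received so far (equivalently, of a
  local state of unbounded size). As usual in this model, only communication is charged and
  local computation is unrestricted. \<open>send A i h v\<close> is the message for the node with identifier
  \<open>v\<close> in the round after history \<open>h\<close>; \<open>decide A i h\<close> is \<open>None\<close> as long as no output is made.\<close>

record ('i, 'o) cc_algorithm =
  send :: "'i \<Rightarrow> inbox list \<Rightarrow> nat \<Rightarrow> message"
  decide :: "'i \<Rightarrow> inbox list \<Rightarrow> 'o option"

text \<open>\<open>history A V inp t v\<close> lists the inboxes of node \<open>v\<close> in the first \<open>t\<close> rounds, where the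
  node set is \<open>V\<close> and \<open>inp u\<close> is the initial knowledge of node \<open>u\<close>.\<close>

primrec history ::
  "('i, 'o) cc_algorithm \<Rightarrow> nat set \<Rightarrow> (nat \<Rightarrow> 'i) \<Rightarrow> nat \<Rightarrow> nat \<Rightarrow> inbox list" where
  "history A V inp 0 = (\<lambda>v. [])"
| "history A V inp (Suc t) = (\<lambda>v. history A V inp t v @
     [\<lambda>u. if u \<in> V \<and> u \<noteq> v then Some (send A (inp u) (history A V inp t u) v) else None])"

definition message_bits_le ::
  "('i, 'o) cc_algorithm \<Rightarrow> nat set \<Rightarrow> (nat \<Rightarrow> 'i) \<Rightarrow> real \<Rightarrow> bool" where
  "message_bits_le A V inp b \<longleftrightarrow>
     (\<forall>t. \<forall>u\<in>V. \<forall>v\<in>V - {u}. real (length (send A (inp u) (history A V inp t u) v)) \<le> b)"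

text \<open>The output of a node is the first value on which it decides; it is irrevocable.\<close>

definition node_outputs ::
  "('i, 'o) cc_algorithm \<Rightarrow> nat set \<Rightarrow> (nat \<Rightarrow> 'i) \<Rightarrow> nat \<Rightarrow> nat \<Rightarrow> 'o \<Rightarrow> bool" where
  "node_outputs A V inp t v out \<longleftrightarrow>
     decide A (inp v) (history A V inp t v) = Some out \<and>
     (\<forall>s<t. decide A (inp v) (history A V inp s v) = None)"

definition all_output_within ::
  "('i, 'o) cc_algorithm \<Rightarrow> nat set \<Rightarrow> (nat \<Rightarrow> 'i) \<Rightarrow> real \<Rightarrow> 'o \<Rightarrow> bool" where
  "all_output_within A V inp R out \<longleftrightarrow>
     (\<forall>v\<in>V. \<exists>t. real t \<le> R \<and> node_outputs A V inp t v out)"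

text \<open>The initial knowledge of a node: the public values \<open>n\<close> (number of nodes) and \<open>r\<close> (the
  parameter of the algorithm), its own identifier, and its incident edges with their weights. In
  particular, an upper bound on all weights of the graph is not given to the nodes.\<close>

record local_input =
  num_nodes :: nat
  parameter :: real
  own_id :: nat
  incident_edges :: "(nat set \<times> nat) set"

definition initial_knowledge ::
  "nat \<Rightarrow> real \<Rightarrow> nat set set \<Rightarrow> (nat set \<Rightarrow> nat) \<Rightarrow> nat \<Rightarrow> local_input" where
  "initial_knowledge n r E w v =
     \<lparr>num_nodes = n, parameter = r, own_id = v,
      incident_edges = {(e, w e) |e. e \<in> E \<and> v \<in> e}\<rparr>"

end

theory Submission
  imports Defs "HOL-Library.Function_Algebras"
begin

text \<open>Local computation is free, so only the communication needs an algorithm: every graph on \<open>n\<close>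
  vertices has a constant-factor spectral sparsifier with \<open>8 n\<close> edges, by the barrier argument of
  Batson, Spielman and Srivastava, and a node may simply pick one. Split the edges into the classes
  of weights in \<open>[2\<^sup>i, 2\<^sup>i\<^sup>+\<^sup>1)\<close>, of which there are \<open>O(log U)\<close>; inside a class the edges
  start out as \<open>n\<close> stars, one per node, with at most \<open>n\<close> edges each. Merging the graphs of
  \<open>k = n powr (1 / r\<^sup>2)\<close> nodes at a time and sparsifying every union leaves a single graph after about
  \<open>r\<^sup>2\<close> levels. Each level loses a constant factor and takes
  \<open>O(k)\<close> rounds, since a node receives \<open>k\<close> graphs with \<open>O(n)\<close> edges each and
  \<open>n\<close> messages per round. Weights are rounded to powers of two, and edges that became much lighter are
  dropped, so that an edge with its weight fits into \<open>O(log n)\<close> bits. Termination is detected by one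
  extra round per class, in which nodes announce whether heavier edges are left.\<close>

section \<open>Sparse approximation of sums of rank-one forms\<close>

text \<open>A Laplacian always has a kernel, and the vectors \<open>nat \<Rightarrow> real\<close>
  form an infinite-dimensional space, so there is no matrix to invert. Forms are kept as weighted
  sums of squared functionals, positivity is measured against \<open>P\<close>, the form with all
  weights 1, and Riesz representers stand in for the inverse. The dimension enters only as the size
  of an independent set of functionals. A constant loss per level is affordable: over at most
  \<open>2 * r\<^sup>2\<close> levels it becomes a constant to the power
  \<open>O(r\<^sup>2)\<close>, and log n, being at least 3/2, absorbs the constant. The condition on
  \<open>r\<close> acts through \<open>r\<^sup>2 \<le> 2 log n\<close>, which limits the number of
  levels and yields the factor log n in the number of rounds. The bit bound shapes the rest. Weights
  are stored as exponents relative to their weight class, so that their range is independent of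
  \<open>U\<close>, which no node knows. By construction of the sparsifier an exponent sinks by at
  most 4 per level; it cannot rise much, because the energy of one edge is at most the total
  energy.\<close>

instantiation "fun" :: (type, real_vector) real_vector
begin

text \<open>With the pointwise addition of functions this serves at two levels: the vectors
  \<open>nat \<Rightarrow> real\<close> become a real vector space, and so do the functionals on
  them, whose rank is measured by \<open>span\<close> and \<open>independent\<close>.\<close>

definition scaleR_fun :: "real \<Rightarrow> ('a \<Rightarrow> 'b) \<Rightarrow> 'a \<Rightarrow> 'b" where
  "scaleR_fun c f = (\<lambda>x. c *\<^sub>R f x)"

instance
  by standard (simp_all add: scaleR_fun_def fun_eq_iff scaleR_add_right scaleR_add_left)

end

definition form :: "'e set \<Rightarrow> ('e \<Rightarrow> 'a \<Rightarrow> real) \<Rightarrow> ('e \<Rightarrow> real) \<Rightarrow> 'a \<Rightarrow> 'a \<Rightarrow> real" where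
  "form S b m x y = (\<Sum>e\<in>S. m e * b e x * b e y)"

lemma form_commute: "form S b m x y = form S b m y x"
  by (simp add: form_def mult_ac)

lemma form_minus: "form S b (\<lambda>e. m e - m' e) x y = form S b m x y - form S b m' x y"
  by (simp add: form_def sum_subtractf algebra_simps)

lemma form_cmult: "form S b (\<lambda>e. c * m e) x y = c * form S b m x y"
  by (simp add: form_def sum_distrib_left algebra_simps)

lemma form_const: "form S b (\<lambda>e. c) x y = c * form S b (\<lambda>_. 1) x y"
  by (simp add: form_def sum_distrib_left algebra_simps)

lemma form_nonneg: "(\<And>e. e \<in> S \<Longrightarrow> 0 \<le> m e) \<Longrightarrow> 0 \<le> form S b m x x"
  unfolding form_def by (intro sum_nonneg) (auto simp: mult.assoc)

lemma form_mono:
  assumes "\<And>e. e \<in> S \<Longrightarrow> m e \<le> m' e"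
  shows "form S b m x x \<le> form S b m' x x"
  unfolding form_def mult.assoc by (intro sum_mono mult_right_mono) (auto simp: assms)

lemma form_fun_upd:
  assumes "finite S" "f \<in> S"
  shows "form S b (m(f := m f + t)) x y = form S b m x y + t * b f x * b f y"
proof -
  have "form S b (m(f := m f + t)) x y
      = (\<Sum>e\<in>S. m e * b e x * b e y + (if e = f then t * b f x * b f y else 0))"
    unfolding form_def by (intro sum.cong) (auto simp: algebra_simps)
  then show ?thesis using assms by (simp add: sum.distrib form_def)
qed

lemma form_one_eq_0:
  assumes "finite S" "form S b (\<lambda>_. 1) x x = 0" "e \<in> S"
  shows "b e x = 0"
proof -
  have "\<forall>e\<in>S. 1 * b e x * b e x = 0"
    using assms by (subst sum_nonneg_eq_0_iff[symmetric]) (auto simp: form_def)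
  then show ?thesis using assms by auto
qed

lemma form_one_insert:
  assumes "finite S" "f \<notin> S"
  shows "form (insert f S) b (\<lambda>_. 1) x y = form S b (\<lambda>_. 1) x y + b f x * b f y"
  using assms by (simp add: form_def)

text \<open>The alternative carried through the induction makes the Riesz representation work although
  the form may be degenerate: a functional is either represented by a vector or separated from
  the family by a common zero. The sum of the leverages \<open>b e (Y e)\<close> is the rank.\<close>

lemma riesz_form_one:
  fixes b :: "'e \<Rightarrow> 'a::real_vector \<Rightarrow> real"
  assumes "finite S" "\<And>e. e \<in> S \<Longrightarrow> linear (b e)"
  shows "(\<exists>Y I. (\<forall>e\<in>S. \<forall>z. form S b (\<lambda>_. 1) (Y e) z = b e z) \<and> I \<subseteq> b ` S \<and> independent I \<and>
            (\<Sum>e\<in>S. b e (Y e)) = real (card I)) \<and>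
         (\<forall>g. linear g \<longrightarrow> (\<exists>y. \<forall>z. form S b (\<lambda>_. 1) y z = g z) \<or>
                            (\<exists>x. (\<forall>e\<in>S. b e x = 0) \<and> g x \<noteq> 0))"
  using assms
proof (induction S rule: finite_induct)
  case empty
  show ?case
  proof (intro conjI allI impI)
    show "\<exists>Y I. (\<forall>e\<in>{}. \<forall>z. form {} b (\<lambda>_. 1) (Y e) z = b e z) \<and> I \<subseteq> b ` {} \<and> independent I \<and>
            (\<Sum>e\<in>{}. b e (Y e)) = real (card I)"
      by (intro exI[of _ "\<lambda>_. 0"] exI[of _ "{}"]) (auto simp: independent_empty)
    fix g :: "'a \<Rightarrow> real"
    show "(\<exists>y. \<forall>z. form {} b (\<lambda>_. 1) y z = g z) \<or> (\<exists>x. (\<forall>e\<in>{}. b e x = 0) \<and> g x \<noteq> 0)"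
      by (auto simp: form_def)
  qed
next
  case (insert f S)
  note lin = insert.prems
  have lf: "linear (b f)" and lS: "\<And>e. e \<in> S \<Longrightarrow> linear (b e)"
    using lin by auto
  obtain Y I where Y: "\<And>e z. e \<in> S \<Longrightarrow> form S b (\<lambda>_. 1) (Y e) z = b e z"
    and I: "I \<subseteq> b ` S" "independent I" "(\<Sum>e\<in>S. b e (Y e)) = real (card I)"
    and alt: "\<And>g. linear g \<Longrightarrow> (\<exists>y. \<forall>z. form S b (\<lambda>_. 1) y z = g z) \<or>
                            (\<exists>x. (\<forall>e\<in>S. b e x = 0) \<and> g x \<noteq> 0)"
    using insert.IH lS by blast
  have lin_comb: "b e (x - c *\<^sub>R y) = b e x - c * b e y" if "e \<in> insert f S" for e x y c
    using lin[OF that] by (simp add: linear_diff linear_scale)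
  have form_comb: "form S b (\<lambda>_. 1) (x - c *\<^sub>R y) z = form S b (\<lambda>_. 1) x z - c * form S b (\<lambda>_. 1) y z"
    for x y z c
    unfolding form_def sum_distrib_left sum_subtractf[symmetric]
    by (intro sum.cong refl) (simp add: lin_comb algebra_simps)
  have ins: "form (insert f S) b (\<lambda>_. 1) x y = form S b (\<lambda>_. 1) x y + b f x * b f y" for x y
    using insert.hyps by (rule form_one_insert)
  \<comment> \<open>Either the old form already represents \<open>b f\<close> and the rank stays, or
    \<open>b f\<close> does not vanish at some common zero of the old functionals and the rank grows
    by one.\<close>
  consider y where "\<And>z. form S b (\<lambda>_. 1) y z = b f z"
    | x where "\<forall>e\<in>S. b e x = 0" "b f x \<noteq> 0"
    using alt[OF lf] by blast
  then show ?case
  proof cases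
    case 1
    define k where "k = b f y"
    have k: "0 \<le> k"
      using 1[of y] form_nonneg[of S "\<lambda>_. 1" b y] by (simp add: k_def)
    \<comment> \<open>Sherman-Morrison: \<open>upd x\<close> represents under the form with
      \<open>f\<close> added whatever \<open>x\<close> represents under the old one.\<close>
    define upd where "upd x = x - (b f x / (1 + k)) *\<^sub>R y" for x
    have upd: "form (insert f S) b (\<lambda>_. 1) (upd x) z = form S b (\<lambda>_. 1) x z" for x z
    proof -
      define c where "c = b f x / (1 + k)"
      have "b f x = c * (1 + k)" using k by (simp add: c_def)
      then show ?thesis
        unfolding ins upd_def form_comb 1 lin_comb[OF insertI1] c_def[symmetric] k_def[symmetric]
        by (simp add: algebra_simps)
    qed
    define Y' where "Y' e = upd (if e = f then y else Y e)" for e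
    have fY: "b f (Y e) = b e y" if "e \<in> S" for e
      using 1[of "Y e"] Y[OF that, of y] by (simp add: form_commute)
    \<comment> \<open>The old leverages lose \<open>k / (1 + k)\<close> in total, which is exactly
      the leverage of the new functional, so the sum remains the rank.\<close>
    have "(\<Sum>e\<in>S. b e (Y' e)) = (\<Sum>e\<in>S. b e (Y e) - b e y * b e y / (1 + k))"
      using insert.hyps fY lin_comb by (intro sum.cong) (auto simp: Y'_def upd_def)
    also have "\<dots> = card I - form S b (\<lambda>_. 1) y y / (1 + k)"
      using I(3) by (simp add: sum_subtractf sum_divide_distrib form_def)
    also have "form S b (\<lambda>_. 1) y y = k"
      by (simp add: 1 k_def)
    finally have "(\<Sum>e\<in>S. b e (Y' e)) = card I - k / (1 + k)" .
    moreover have "b f (Y' f) = k / (1 + k)"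
      using k by (simp add: Y'_def upd_def lin_comb[OF insertI1] k_def[symmetric])
        (simp add: field_simps)
    ultimately have s: "(\<Sum>e\<in>insert f S. b e (Y' e)) = card I"
      using insert.hyps by simp
    show ?thesis
    proof (intro conjI allI impI)
      show "\<exists>Y I. (\<forall>e\<in>insert f S. \<forall>z. form (insert f S) b (\<lambda>_. 1) (Y e) z = b e z) \<and>
              I \<subseteq> b ` insert f S \<and> independent I \<and>
            (\<Sum>e\<in>insert f S. b e (Y e)) = real (card I)"
        using s I upd Y 1 insert.hyps
        by (intro exI[of _ Y'] exI[of _ I]) (auto simp: Y'_def)
      fix g :: "'a \<Rightarrow> real" assume g: "linear g"
      from alt[OF g] show "(\<exists>y. \<forall>z. form (insert f S) b (\<lambda>_. 1) y z = g z) \<or>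
                            (\<exists>x. (\<forall>e\<in>insert f S. b e x = 0) \<and> g x \<noteq> 0)"
      proof (elim disjE exE conjE)
        fix u assume "\<forall>z. form S b (\<lambda>_. 1) u z = g z"
        then show ?thesis using upd by metis
      next
        fix x assume x: "\<forall>e\<in>S. b e x = 0" "g x \<noteq> 0"
        then have "b f x = 0" using 1[of x, symmetric] by (simp add: form_def)
        then show ?thesis using x by auto
      qed
    qed
  next
    case (2 x0)
    \<comment> \<open>Scaled to \<open>b f x = 1\<close>, so that \<open>x\<close> represents
      \<open>b f\<close> under the new form; multiples of \<open>x\<close> then correct the other
      representers without affecting the old functionals.\<close>
    define x where "x = (1 / b f x0) *\<^sub>R x0"
    have x: "\<And>e. e \<in> S \<Longrightarrow> b e x = 0" "b f x = 1"
      using 2 lin by (auto simp: x_def linear_scale)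
    have x_form: "form S b (\<lambda>_. 1) x z = 0" for z
      by (simp add: form_def x)
    define Y' where "Y' e = (if e = f then x else Y e - b f (Y e) *\<^sub>R x)" for e
    have Y': "form (insert f S) b (\<lambda>_. 1) (Y' e) z = b e z" if "e \<in> insert f S" for e z
      using that x Y insert.hyps
      by (auto simp: ins Y'_def lin_comb form_comb x_form)
    have notin: "b f \<notin> span (b ` S)"
    proof
      assume "b f \<in> span (b ` S)"
      moreover have "b ` S \<subseteq> {g. g x = 0}" using x by auto
      moreover have "subspace {g :: 'a \<Rightarrow> real. g x = 0}"
        by (auto simp: subspace_def scaleR_fun_def)
      ultimately have "b f \<in> {g. g x = 0}" using span_minimal by blast
      with x show False by simp
    qed
    have fI: "finite I" using I(1) insert.hyps by (meson finite_imageI finite_subset)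
    have bf: "b f \<notin> span I" using notin I(1) span_mono by blast
    then have bfI: "b f \<notin> I" using span_base by blast
    have "(\<Sum>e\<in>S. b e (Y' e)) = (\<Sum>e\<in>S. b e (Y e))"
      using insert.hyps x by (intro sum.cong) (auto simp: Y'_def lin_comb)
    then have s: "(\<Sum>e\<in>insert f S. b e (Y' e)) = card (insert (b f) I)"
      using insert.hyps x I fI bfI by (simp add: Y'_def)
    show ?thesis
    proof (intro conjI allI impI)
      show "\<exists>Y I. (\<forall>e\<in>insert f S. \<forall>z. form (insert f S) b (\<lambda>_. 1) (Y e) z = b e z) \<and>
              I \<subseteq> b ` insert f S \<and> independent I \<and>
            (\<Sum>e\<in>insert f S. b e (Y e)) = real (card I)"
        using s Y' I independent_insertI[OF bf I(2)]
        by (intro exI[of _ Y'] exI[of _ "insert (b f) I"]) auto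
      fix g :: "'a \<Rightarrow> real" assume g: "linear g"
      \<comment> \<open>Chosen to vanish at \<open>x\<close>; either alternative for
        \<open>g'\<close> carries over to \<open>g\<close> after adding a multiple of
        \<open>x\<close> to the vector.\<close>
      define g' where "g' z = g z - g x * b f z" for z
      have "linear g'"
        unfolding g'_def using g lf
        by (intro linear_compose_sub) (simp_all add: linear_iff algebra_simps)
      from alt[OF this] show "(\<exists>y. \<forall>z. form (insert f S) b (\<lambda>_. 1) y z = g z) \<or>
                            (\<exists>x. (\<forall>e\<in>insert f S. b e x = 0) \<and> g x \<noteq> 0)"
      proof (elim disjE exE conjE)
        fix u assume u: "\<forall>z. form S b (\<lambda>_. 1) u z = g' z"
        have "form (insert f S) b (\<lambda>_. 1) (u - (b f u - g x) *\<^sub>R x) z = g z" for z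
          using u by (simp add: ins form_comb x_form lin_comb x g'_def)
        then show ?thesis by blast
      next
        fix u assume u: "\<forall>e\<in>S. b e u = 0" "g' u \<noteq> 0"
        have "\<forall>e\<in>insert f S. b e (u - b f u *\<^sub>R x) = 0"
          using u x by (auto simp: lin_comb)
        moreover have "g (u - b f u *\<^sub>R x) \<noteq> 0"
          using u g by (simp add: g'_def linear_diff linear_scale mult.commute)
        ultimately show ?thesis by blast
      qed
    qed
  qed
qed

section \<open>Positivity, representers and leverages of a family of functionals\<close>

locale functionals =
  fixes S :: "'e set" and b :: "'e \<Rightarrow> 'a::real_vector \<Rightarrow> real"
  assumes finite_S: "finite S" and linear_b: "e \<in> S \<Longrightarrow> linear (b e)"
begin

abbreviation Q :: "('e \<Rightarrow> real) \<Rightarrow> 'a \<Rightarrow> 'a \<Rightarrow> real" where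
  "Q \<equiv> form S b"

abbreviation P :: "'a \<Rightarrow> 'a \<Rightarrow> real" where
  "P \<equiv> form S b (\<lambda>_. 1)"

text \<open>Positive definite modulo the common kernel of the functionals. The uniform
  \<open>\<kappa>\<close> lets the property pass along comparisons of forms without a compactness
  argument.\<close>

definition pos :: "('e \<Rightarrow> real) \<Rightarrow> bool" where
  "pos m \<longleftrightarrow> (\<exists>\<kappa>>0. \<forall>x. \<kappa> * P x x \<le> Q m x x)"

lemma P_nonneg: "0 \<le> P x x"
  by (rule form_nonneg) simp

lemma pos_nonneg:
  assumes "pos m" shows "0 \<le> Q m x x"
proof -
  obtain \<kappa> where "\<kappa> > 0" "\<kappa> * P x x \<le> Q m x x" using assms unfolding pos_def by blast
  then show ?thesis using P_nonneg[of x] mult_nonneg_nonneg[of \<kappa> "P x x"] by linarith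
qed

lemma pos_zero:
  assumes "pos m" "Q m x x \<le> 0" "e \<in> S" shows "b e x = 0"
proof -
  obtain \<kappa> where "\<kappa> > 0" "\<kappa> * P x x \<le> Q m x x" using assms(1) unfolding pos_def by blast
  then have "\<kappa> * P x x \<le> 0" using assms(2) by linarith
  then have "P x x = 0" using \<open>\<kappa> > 0\<close> P_nonneg[of x] by (simp add: mult_le_0_iff)
  then show ?thesis by (rule form_one_eq_0[OF finite_S _ assms(3)])
qed

lemma pos_mono:
  assumes "pos m" "\<And>x. c * Q m x x \<le> Q m' x x" "c > 0"
  shows "pos m'"
proof -
  obtain \<kappa> where \<kappa>: "\<kappa> > 0" "\<And>x. \<kappa> * P x x \<le> Q m x x" using assms(1) unfolding pos_def by blast
  have "c * \<kappa> * P x x \<le> Q m' x x" for x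
  proof -
    have "c * (\<kappa> * P x x) \<le> c * Q m x x" using \<kappa>(2) assms(3) by simp
    then show ?thesis using assms(2)[of x] by (simp add: mult.assoc)
  qed
  then show ?thesis unfolding pos_def using \<kappa>(1) assms(3) by (intro exI[of _ "c * \<kappa>"]) simp
qed

lemma b_diff_scale: "e \<in> S \<Longrightarrow> b e (x - c *\<^sub>R y) = b e x - c * b e y"
  using linear_b by (simp add: linear_diff linear_scale)

lemma b_scale: "e \<in> S \<Longrightarrow> b e (c *\<^sub>R y) = c * b e y"
  using linear_b by (simp add: linear_scale)

lemma Q_diff_scale: "Q m (x - c *\<^sub>R y) z = Q m x z - c * Q m y z"
  unfolding form_def sum_distrib_left sum_subtractf[symmetric]
  by (intro sum.cong refl) (simp add: b_diff_scale algebra_simps)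

lemma Q_scale: "Q m (c *\<^sub>R y) z = c * Q m y z"
  unfolding form_def sum_distrib_left
  by (intro sum.cong refl) (simp add: b_scale algebra_simps)

lemma Q_diff_square: "Q m (x - y) (x - y) = Q m x x - 2 * Q m x y + Q m y y"
proof -
  have "Q m (x - y) (x - y) = (\<Sum>e\<in>S. (m e * b e x * b e x - 2 * (m e * b e x * b e y)) + m e * b e y * b e y)"
    unfolding form_def using linear_b
    by (intro sum.cong refl) (simp add: linear_diff algebra_simps)
  then show ?thesis
    by (simp only: sum.distrib sum_subtractf sum_distrib_left[symmetric] form_def)
qed

text \<open>The Sherman-Morrison formula, with representers in place of the inverse matrix.\<close>

lemma riesz_rank_one:
  assumes f: "f \<in> S" and y: "\<And>z. Q m y z = b f z" and x: "\<And>z. Q m x z = g z"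
    and t: "1 + t * b f y \<noteq> 0"
  shows "Q (m(f := m f + t)) (x - (t * b f x / (1 + t * b f y)) *\<^sub>R y) z = g z"
proof -
  define c where "c = t * b f x / (1 + t * b f y)"
  have "c * (1 + t * b f y) = t * b f x" using t by (simp add: c_def)
  then have c: "t * b f x = c + t * c * b f y" by (simp add: algebra_simps)
  have "Q (m(f := m f + t)) (x - c *\<^sub>R y) z
      = Q m (x - c *\<^sub>R y) z + t * b f (x - c *\<^sub>R y) * b f z"
    using finite_S f by (rule form_fun_upd)
  also have "\<dots> = g z - c * b f z + (t * b f x - t * c * b f y) * b f z"
    using f by (simp add: Q_diff_scale b_diff_scale x y algebra_simps)
  also have "\<dots> = g z" by (simp add: c)
  finally show ?thesis by (simp add: c_def)
qed

text \<open>For a constant weight \<open>K\<close> dominating \<open>m\<close> the form is a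
  multiple of \<open>P\<close>, where representers are known. The weights are then lowered to
  \<open>m\<close> one functional at a time by rank-one changes.\<close>

lemma riesz:
  assumes m: "pos m" and e: "e \<in> S"
  shows "\<exists>y. \<forall>z. Q m y z = b e z"
proof -
  define K where "K = 1 + (\<Sum>e\<in>S. \<bar>m e\<bar>)"
  have K: "m e \<le> K" if "e \<in> S" for e
    using member_le_sum[OF that, of "\<lambda>e. \<bar>m e\<bar>"] finite_S by (auto simp: K_def)
  have K0: "0 < K" by (auto simp: K_def intro!: add_pos_nonneg sum_nonneg)
  have "D \<subseteq> S \<longrightarrow> (\<forall>e\<in>S. \<exists>y. \<forall>z. Q (\<lambda>e. if e \<in> D then m e else K) y z = b e z)"
    if "finite D" for D
    using that
  proof (induction D rule: finite_induct)
    case empty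
    show ?case
    proof (intro impI ballI)
      fix e assume "e \<in> S"
      then obtain y where y: "\<And>z. P y z = b e z"
        using riesz_form_one[of S b] finite_S linear_b by blast
      have "Q (\<lambda>e. K) ((1 / K) *\<^sub>R y) z = b e z" for z
        using K0 by (simp add: Q_scale form_const[of S b K] y)
      then show "\<exists>y. \<forall>z. Q (\<lambda>e. if e \<in> {} then m e else K) y z = b e z" by auto
    qed
  next
    case (insert f D)
    show ?case
    proof (intro impI ballI)
      fix e assume D: "insert f D \<subseteq> S" and e: "e \<in> S"
      define m0 where "m0 = (\<lambda>e. if e \<in> D then m e else K)"
      define t where "t = m f - K"
      have upd: "(\<lambda>e. if e \<in> insert f D then m e else K) = m0(f := m0 f + t)"
        using insert.hyps by (auto simp: m0_def t_def)
      obtain y where y: "\<And>z. Q m0 y z = b f z"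
        using insert.IH D unfolding m0_def by blast
      obtain x where x: "\<And>z. Q m0 x z = b e z"
        using insert.IH D e unfolding m0_def by blast
      \<comment> \<open>The lowered form still dominates \<open>Q m\<close>. A vanishing denominator
        would make it 0 at \<open>y\<close>, hence \<open>b f y = 0\<close> by positivity of
        \<open>m\<close>, and then the denominator is 1.\<close>
      have "1 + t * b f y \<noteq> 0"
      proof
        assume 0: "1 + t * b f y = 0"
        have "Q m y y \<le> Q (m0(f := m0 f + t)) y y"
          by (rule form_mono) (use insert.hyps in \<open>auto simp: m0_def t_def K\<close>)
        also have "\<dots> = Q m0 y y + t * b f y * b f y"
          using finite_S D by (intro form_fun_upd) auto
        also have "\<dots> = (1 + t * b f y) * b f y"
          by (simp add: y algebra_simps)
        finally have "b f y = 0" using pos_zero[OF m, of y f] D 0 by simp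
        then show False using 0 by simp
      qed
      then have "\<And>z. Q (m0(f := m0 f + t)) (x - (t * b f x / (1 + t * b f y)) *\<^sub>R y) z = b e z"
        using D x y by (intro riesz_rank_one) auto
      then show "\<exists>y. \<forall>z. Q (\<lambda>e. if e \<in> insert f D then m e else K) y z = b e z"
        unfolding upd by blast
    qed
  qed
  from this[OF finite_S] e have "\<exists>y. \<forall>z. Q (\<lambda>e. if e \<in> S then m e else K) y z = b e z" by blast
  moreover have "Q (\<lambda>e. if e \<in> S then m e else K) = Q m"
    unfolding form_def by (intro ext sum.cong) auto
  ultimately show ?thesis by simp
qed

definition rep :: "('e \<Rightarrow> real) \<Rightarrow> 'e \<Rightarrow> 'a" where
  "rep m e = (SOME y. \<forall>z. Q m y z = b e z)"

text \<open>With \<open>M = \<Sum> m e b e b e\<^sup>T\<close> and \<open>P = \<Sum> b e b e\<^sup>T\<close>, the following are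
  \<open>b e\<^sup>T M\<^sup>-\<^sup>1 b e\<close>, \<open>b e\<^sup>T M\<^sup>-\<^sup>1 P M\<^sup>-\<^sup>1 b e\<close> and \<open>tr (P M\<^sup>-\<^sup>1)\<close>.\<close>

definition lev :: "('e \<Rightarrow> real) \<Rightarrow> 'e \<Rightarrow> real" where
  "lev m e = b e (rep m e)"

definition lev2 :: "('e \<Rightarrow> real) \<Rightarrow> 'e \<Rightarrow> real" where
  "lev2 m e = P (rep m e) (rep m e)"

definition tr :: "('e \<Rightarrow> real) \<Rightarrow> real" where
  "tr m = (\<Sum>e\<in>S. lev m e)"

lemma rep: "pos m \<Longrightarrow> e \<in> S \<Longrightarrow> Q m (rep m e) z = b e z"
  unfolding rep_def by (rule someI2_ex[OF riesz]) auto

lemma Q_rep_self: "pos m \<Longrightarrow> e \<in> S \<Longrightarrow> Q m (rep m e) (rep m e) = lev m e"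
  by (simp add: rep lev_def)

text \<open>Representers are unique only modulo the kernel; symmetry of the form shows that the
  leverage does not see the choice.\<close>

lemma lev_unique:
  assumes "pos m" "e \<in> S" "\<And>z. Q m y z = b e z"
  shows "b e y = lev m e"
proof -
  have "b e y = Q m (rep m e) y" using assms by (simp add: rep)
  also have "\<dots> = Q m y (rep m e)" by (rule form_commute)
  finally show ?thesis using assms by (simp add: lev_def)
qed

text \<open>Variational description of the leverage as a maximum over test vectors \<open>y\<close>,
  obtained by expanding a square. Testing it replaces monotonicity and convexity of matrix inversion
  below.\<close>

lemma lev_ge:
  assumes "pos m" "e \<in> S"
  shows "2 * b e y - Q m y y \<le> lev m e"
proof -
  have "0 \<le> Q m (rep m e - y) (rep m e - y)" by (rule pos_nonneg[OF assms(1)])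
  then show ?thesis using assms by (simp add: Q_diff_square rep lev_def)
qed

lemma lev_nonneg: "pos m \<Longrightarrow> e \<in> S \<Longrightarrow> 0 \<le> lev m e"
  using pos_nonneg[of m "rep m e"] by (simp add: Q_rep_self)

text \<open>The bound \<open>lev_ge\<close> optimised over the multiples of
  \<open>x\<close>.\<close>

lemma cauchy_schwarz_lev:
  assumes "pos m" "e \<in> S"
  shows "(b e x)\<^sup>2 \<le> lev m e * Q m x x"
proof (cases "Q m x x = 0")
  case True
  then show ?thesis using pos_zero[OF assms(1) _ assms(2), of x] by simp
next
  case False
  then have q: "Q m x x > 0" using pos_nonneg[OF assms(1), of x] by simp
  define c where "c = b e x / Q m x x"
  have "2 * b e (c *\<^sub>R x) - Q m (c *\<^sub>R x) (c *\<^sub>R x) \<le> lev m e"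
    by (rule lev_ge[OF assms])
  moreover have "Q m (c *\<^sub>R x) (c *\<^sub>R x) = c * (c * Q m x x)"
    using Q_scale[of m c x "c *\<^sub>R x"] Q_scale[of m c x x] by (simp add: form_commute)
  moreover have "c * Q m x x = b e x" using q by (simp add: c_def)
  ultimately have "c * b e x \<le> lev m e" using b_scale[OF assms(2)] by simp
  then have "c * b e x * Q m x x \<le> lev m e * Q m x x" using q by (intro mult_right_mono) auto
  also have "c * b e x * Q m x x = (b e x)\<^sup>2" using q by (simp add: c_def power2_eq_square)
  finally show ?thesis .
qed

text \<open>Cauchy-Schwarz summed over \<open>S\<close>. A potential of at most 1/4 thus means that
  the form is at least \<open>4 * P\<close>, a definite distance to the barrier.\<close>

lemma P_le_tr: "pos m \<Longrightarrow> P x x \<le> tr m * Q m x x"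
  unfolding tr_def sum_distrib_right form_def[of S b "\<lambda>_. 1"]
  by (intro sum_mono) (use cauchy_schwarz_lev in \<open>auto simp: power2_eq_square\<close>)

lemma lev2_pos:
  assumes "pos m" "e \<in> S" "b e x \<noteq> 0"
  shows "0 < lev2 m e"
proof -
  have "lev m e \<noteq> 0" using cauchy_schwarz_lev[OF assms(1,2), of x] assms(3) by auto
  then have "P (rep m e) (rep m e) \<noteq> 0"
    using form_one_eq_0[OF finite_S _ assms(2), of b "rep m e"] unfolding lev_def by metis
  then show ?thesis using P_nonneg unfolding lev2_def by (simp add: less_le)
qed

text \<open>The potential is convex in \<open>\<delta>\<close> and lies above its tangent; the proof
  tests \<open>lev_ge\<close> with the unshifted representer. The sign of \<open>\<delta>\<close> is
  free: 4 is used for the upper and -1 for the lower barrier.\<close>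

lemma tr_shift:
  assumes "pos m" "pos (\<lambda>e. m e - \<delta>)"
  shows "tr m + \<delta> * (\<Sum>e\<in>S. lev2 m e) \<le> tr (\<lambda>e. m e - \<delta>)"
proof -
  have "lev m e + \<delta> * lev2 m e \<le> lev (\<lambda>e. m e - \<delta>) e" if e: "e \<in> S" for e
    using lev_ge[OF assms(2) e, of "rep m e"] assms(1) e
    by (simp add: form_minus form_const[of S b \<delta>] Q_rep_self lev2_def lev_def[symmetric])
  then show ?thesis
    unfolding tr_def by (simp add: sum_distrib_left sum.distrib[symmetric] sum_mono)
qed

text \<open>Inversion reverses the order of forms. The test vector for \<open>lev_ge\<close> is half
  the representer under \<open>m'\<close>, the best multiple for the factor 2.\<close>

lemma tr_comparison:
  assumes "pos m" "pos m'" "\<And>x. Q m x x \<le> 2 * Q m' x x"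
  shows "tr m' \<le> 2 * tr m"
proof -
  have "lev m' e \<le> 2 * lev m e" if e: "e \<in> S" for e
  proof -
    define s where "s = rep m' e"
    have "Q m ((1/2) *\<^sub>R s) ((1/2) *\<^sub>R s) = 1/4 * Q m s s"
      using Q_scale[of m "1/2" s "(1/2) *\<^sub>R s"] Q_scale[of m "1/2" s s] by (simp add: form_commute)
    then have "b e s - 1/4 * Q m s s \<le> lev m e"
      using lev_ge[OF assms(1) e, of "(1/2) *\<^sub>R s"] b_scale[OF e, of "1/2" s] by simp
    moreover have "Q m s s \<le> 2 * lev m' e"
      using assms(3)[of s] Q_rep_self[OF assms(2) e] by (simp add: s_def)
    ultimately show ?thesis by (simp add: s_def lev_def[symmetric])
  qed
  then show ?thesis unfolding tr_def sum_distrib_left by (intro sum_mono)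
qed

text \<open>Sherman-Morrison summed over \<open>S\<close>; the squares collect to
  \<open>lev2 m f\<close> because \<open>b f (rep m e) = b e (rep m f)\<close>.\<close>

lemma tr_rank_one:
  assumes m: "pos m" and f: "f \<in> S" and m': "pos (m(f := m f + t))"
    and t: "1 + t * lev m f \<noteq> 0"
  shows "tr (m(f := m f + t)) = tr m - t * lev2 m f / (1 + t * lev m f)"
proof -
  define c where "c = t / (1 + t * lev m f)"
  have "lev (m(f := m f + t)) e = lev m e - c * (1 * b e (rep m f) * b e (rep m f))"
    if e: "e \<in> S" for e
  proof -
    have sym: "b f (rep m e) = b e (rep m f)"
      using rep[OF m f, of "rep m e"] rep[OF m e, of "rep m f"] by (simp add: form_commute)
    let ?y = "rep m e - (t * b f (rep m e) / (1 + t * lev m f)) *\<^sub>R rep m f"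
    have "b e ?y = lev (m(f := m f + t)) e"
      using riesz_rank_one[OF f rep[OF m f] rep[OF m e]] t lev_def
      by (intro lev_unique[OF m' e]) auto
    then show ?thesis using b_diff_scale[OF e] by (simp add: sym lev_def[symmetric] c_def)
  qed
  then have "tr (m(f := m f + t)) = tr m - c * lev2 m f"
    unfolding tr_def lev2_def form_def sum_distrib_left sum_subtractf[symmetric]
    by (intro sum.cong) auto
  then show ?thesis by (simp add: c_def)
qed

text \<open>One step of a simplified barrier argument of Batson, Spielman and Srivastava: the upper
  barrier moves by 4, the lower one by 1, and both potentials stay at most 1/4. The step size \<open>t\<close>
  exists since, summed over \<open>S\<close>, the upper bounds on \<open>1 / t\<close> dominate the lower ones.\<close>

lemma barrier_step:
  assumes up: "pos (\<lambda>e. u - a e)" "tr (\<lambda>e. u - a e) \<le> 1/4"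
    and lo: "pos (\<lambda>e. a e - l)" "tr (\<lambda>e. a e - l) \<le> 1/4"
    and S: "S \<noteq> {}" and nz: "\<And>e. e \<in> S \<Longrightarrow> \<exists>x. b e x \<noteq> 0"
  obtains f t where "f \<in> S" "0 < t"
    "pos (\<lambda>e. u + 4 - (a(f := a f + t)) e)" "tr (\<lambda>e. u + 4 - (a(f := a f + t)) e) \<le> 1/4"
    "pos (\<lambda>e. (a(f := a f + t)) e - (l + 1))" "tr (\<lambda>e. (a(f := a f + t)) e - (l + 1)) \<le> 1/4"
proof -
  \<comment> \<open>Both barriers move first, with \<open>a\<close> unchanged; the increment
    \<open>t\<close> follows as a rank-one change of \<open>M1\<close> and
    \<open>M2\<close>.\<close>
  define M1 where "M1 = (\<lambda>e. u + 4 - a e)"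
  define M2 where "M2 = (\<lambda>e. a e - (l + 1))"
  have M1_shift: "(\<lambda>e. M1 e - 4) = (\<lambda>e. u - a e)" and M2_shift: "(\<lambda>e. M2 e - (-1)) = (\<lambda>e. a e - l)"
    by (auto simp: M1_def M2_def)
  have Q1: "Q (\<lambda>e. u - a e) x x = Q M1 x x - 4 * P x x" for x
    using form_minus[of S b M1 "\<lambda>_. 4" x x] form_const[of S b 4 x x] unfolding M1_shift by simp
  have Q2: "Q (\<lambda>e. a e - l) x x = Q M2 x x + P x x" for x
    using form_minus[of S b M2 "\<lambda>_. -1" x x] form_const[of S b "-1" x x] unfolding M2_shift by simp
  \<comment> \<open>The potential bound gives \<open>P\<close> at most a quarter of the old lower
    form, so moving the lower barrier by 1 keeps more than half of it.\<close>
  have half: "Q (\<lambda>e. a e - l) x x \<le> 2 * Q M2 x x" for x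
  proof -
    have "P x x \<le> tr (\<lambda>e. a e - l) * Q (\<lambda>e. a e - l) x x" by (rule P_le_tr[OF lo(1)])
    also have "\<dots> \<le> 1/4 * Q (\<lambda>e. a e - l) x x"
      by (rule mult_right_mono[OF lo(2) pos_nonneg[OF lo(1)]])
    finally show ?thesis using Q2[of x] P_nonneg[of x] by linarith
  qed
  have pos1: "pos M1"
    by (rule pos_mono[OF up(1), of 1]) (use Q1 P_nonneg in auto)
  have pos2: "pos M2"
  proof (rule pos_mono[OF lo(1), of "1/2"])
    show "1/2 * Q (\<lambda>e. a e - l) x x \<le> Q M2 x x" for x using half[of x] by simp
  qed simp
  define s1 where "s1 = (\<Sum>e\<in>S. lev2 M1 e)"
  define s2 where "s2 = (\<Sum>e\<in>S. lev2 M2 e)"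
  have l1: "0 < lev2 M1 e" and l2: "0 < lev2 M2 e" if "e \<in> S" for e
    using lev2_pos[OF pos1 that] lev2_pos[OF pos2 that] nz[OF that] by auto
  have s1: "0 < s1" and s2: "0 < s2"
    unfolding s1_def s2_def using l1 l2 S finite_S by (auto intro: sum_pos)
  have sh1: "tr M1 + 4 * s1 \<le> tr (\<lambda>e. u - a e)"
    using tr_shift[of M1 4] pos1 up(1) unfolding M1_shift s1_def by simp
  have sh2: "tr M2 - s2 \<le> tr (\<lambda>e. a e - l)"
    using tr_shift[of M2 "-1"] pos2 lo(1) unfolding M2_shift s2_def by simp
  have tr2: "tr M2 \<le> 1/2"
    using tr_comparison[OF lo(1) pos2 half] lo(2) by simp
  have tr1: "tr M1 \<le> 1/4" using sh1 s1 up(2) by simp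
  \<comment> \<open>The upper potential survives if \<open>1 / t\<close> is at least the left side,
    the lower one if it is at most the right side. Summed over \<open>S\<close> the left side is
    \<open>1/4 + tr M1 \<le> 1/2\<close> and the right side \<open>1 - tr M2 \<ge> 1/2\<close>: the
    speeds 4 and 1 and the bound 1/4 are balanced for this.\<close>
  have "\<exists>f\<in>S. lev2 M1 f / (4 * s1) + lev M1 f \<le> lev2 M2 f / s2 - lev M2 f"
  proof (rule ccontr)
    assume "\<not> ?thesis"
    then have "(\<Sum>f\<in>S. lev2 M2 f / s2 - lev M2 f) < (\<Sum>f\<in>S. lev2 M1 f / (4 * s1) + lev M1 f)"
      using finite_S S by (intro sum_strict_mono) auto
    then have "s2 / s2 - tr M2 < s1 / (4 * s1) + tr M1"
      by (simp add: sum_subtractf sum.distrib sum_divide_distrib[symmetric] tr_def s1_def s2_def)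
    then show False using tr1 tr2 s1 s2 by simp
  qed
  then obtain f where f: "f \<in> S" "lev2 M1 f / (4 * s1) + lev M1 f \<le> lev2 M2 f / s2 - lev M2 f"
    by blast
  define q where "q = lev2 M1 f / (4 * s1)"
  \<comment> \<open>With the smallest admissible \<open>1 / t\<close> the upper potential rises by
    \<open>lev2 M1 f / q\<close>, exactly the \<open>4 * s1\<close> that the shift gained.\<close>
  define t where "t = 1 / (q + lev M1 f)"
  have q: "0 < q" using l1[OF f(1)] s1 by (simp add: q_def)
  have qk: "0 < q + lev M1 f" using q lev_nonneg[OF pos1 f(1)] by simp
  then have t: "0 < t" by (simp add: t_def)
  have tq: "t * (q + lev M1 f) = 1" using qk by (simp add: t_def)
  then have tk1: "1 + (-t) * lev M1 f = t * q" by (simp add: algebra_simps)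
  have upd1: "(\<lambda>e. u + 4 - (a(f := a f + t)) e) = M1(f := M1 f + (-t))"
    and upd2: "(\<lambda>e. (a(f := a f + t)) e - (l + 1)) = M2(f := M2 f + t)"
    by (auto simp: M1_def M2_def)
  have pos1': "pos (M1(f := M1 f + (-t)))"
  proof (rule pos_mono[OF pos1, of "t * q"])
    fix x
    have "t * (b f x)\<^sup>2 \<le> t * (lev M1 f * Q M1 x x)"
      using cauchy_schwarz_lev[OF pos1 f(1), of x] t by (intro mult_left_mono) auto
    then show "t * q * Q M1 x x \<le> Q (M1(f := M1 f + (-t))) x x"
      unfolding form_fun_upd[OF finite_S f(1)] tk1[symmetric]
      by (simp add: algebra_simps power2_eq_square)
  qed (use t q in simp)
  have pos2': "pos (M2(f := M2 f + t))"
    by (rule pos_mono[OF pos2, of 1])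
      (use t in \<open>auto simp: form_fun_upd[OF finite_S f(1)] mult.assoc\<close>)
  have "tr (M1(f := M1 f + (-t))) = tr M1 - (-t) * lev2 M1 f / (1 + (-t) * lev M1 f)"
    using pos1 f(1) pos1' by (rule tr_rank_one) (use tk1 t q in simp)
  also have "\<dots> = tr M1 + lev2 M1 f / q" using t unfolding tk1 by simp
  also have "lev2 M1 f / q = 4 * s1" using q s1 l1[OF f(1)] by (simp add: q_def)
  finally have r1: "tr (M1(f := M1 f + (-t))) \<le> 1/4" using sh1 up(2) by linarith
  have k2: "0 < 1 + t * lev M2 f" using t lev_nonneg[OF pos2 f(1)] by (simp add: add_pos_nonneg)
  have "1 \<le> t * (lev2 M2 f / s2 - lev M2 f)"
    using f(2) t tq mult_left_mono[of "q + lev M1 f" "lev2 M2 f / s2 - lev M2 f" t] by (simp add: q_def)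
  then have "1 + t * lev M2 f \<le> t * lev2 M2 f / s2" by (simp add: algebra_simps)
  then have "s2 * (1 + t * lev M2 f) \<le> t * lev2 M2 f" using s2 by (simp add: field_simps)
  then have "s2 \<le> t * lev2 M2 f / (1 + t * lev M2 f)" using k2 by (simp add: pos_le_divide_eq)
  moreover have "tr (M2(f := M2 f + t)) = tr M2 - t * lev2 M2 f / (1 + t * lev M2 f)"
    using pos2 f(1) pos2' by (rule tr_rank_one) (use k2 in simp)
  ultimately have r2: "tr (M2(f := M2 f + t)) \<le> 1/4" using sh2 lo(2) by linarith
  show thesis
    using that[OF f(1) t] pos1' pos2' r1 r2 unfolding upd1 upd2 by blast
qed

lemma pos_const: "0 < c \<Longrightarrow> pos (\<lambda>_. c)"
  unfolding pos_def by (intro exI[of _ c]) (simp add: form_const[of S b c])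

text \<open>The leverages with respect to \<open>P\<close> itself sum to the rank of the family, and
  no independent set in \<open>span C\<close> exceeds \<open>card C\<close>.\<close>

lemma tr_const:
  assumes "0 < c" "finite C" "b ` S \<subseteq> span C"
  shows "c * tr (\<lambda>_. c) \<le> card C"
proof -
  obtain Y I where Y: "\<And>e z. e \<in> S \<Longrightarrow> P (Y e) z = b e z"
    and I: "I \<subseteq> b ` S" "independent I" "(\<Sum>e\<in>S. b e (Y e)) = real (card I)"
    using riesz_form_one[of S b] finite_S linear_b by blast
  have pos_c: "pos (\<lambda>_. c)" using assms(1) by (rule pos_const)
  have "c * lev (\<lambda>_. c) e = b e (Y e)" if e: "e \<in> S" for e
  proof -
    have "b e ((1 / c) *\<^sub>R Y e) = lev (\<lambda>_. c) e"
      using assms(1) by (intro lev_unique[OF pos_c e]) (simp add: Q_scale form_const[of S b c] Y[OF e])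
    then show ?thesis using assms(1) b_scale[OF e] by (simp add: field_simps)
  qed
  then have "c * tr (\<lambda>_. c) = card I"
    unfolding tr_def sum_distrib_left I(3)[symmetric] by (intro sum.cong) auto
  also have "card I \<le> card C"
    using independent_span_bound[OF assms(2) I(2)] I(1) assms(3) by auto
  finally show ?thesis by simp
qed

lemma barrier_iterate:
  assumes S: "S \<noteq> {}" and nz: "\<And>e. e \<in> S \<Longrightarrow> \<exists>x. b e x \<noteq> 0"
    and C: "finite C" "b ` S \<subseteq> span C" "0 < card C"
  shows "\<exists>a :: 'e \<Rightarrow> real. (\<forall>e. 0 \<le> a e) \<and> {e. a e \<noteq> 0} \<subseteq> S \<and> card {e. a e \<noteq> 0} \<le> k \<and>
    pos (\<lambda>e. real (4 * card C + 4 * k) - a e) \<and> tr (\<lambda>e. real (4 * card C + 4 * k) - a e) \<le> 1/4 \<and>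
    pos (\<lambda>e. a e - (real k - 4 * card C)) \<and> tr (\<lambda>e. a e - (real k - 4 * card C)) \<le> 1/4"
proof (induction k)
  case 0
  \<comment> \<open>The barriers start at plus and minus \<open>4 * card C\<close> with
    \<open>a = 0\<close>: both forms are \<open>?c\<close> times \<open>P\<close>, of potential at
    most \<open>card C / ?c = 1/4\<close>.\<close>
  let ?c = "real (4 * card C)"
  have "pos (\<lambda>_. ?c)" using C(3) by (intro pos_const) simp
  moreover have "tr (\<lambda>_. ?c) \<le> 1/4"
    using tr_const[of ?c C] C by (simp add: field_simps)
  ultimately show ?case by (intro exI[of _ "\<lambda>_. 0"]) simp
next
  case (Suc k)
  then obtain a :: "'e \<Rightarrow> real" where a: "\<And>e. 0 \<le> a e" "{e. a e \<noteq> 0} \<subseteq> S" "card {e. a e \<noteq> 0} \<le> k"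
    and up: "pos (\<lambda>e. real (4 * card C + 4 * k) - a e)" "tr (\<lambda>e. real (4 * card C + 4 * k) - a e) \<le> 1/4"
    and lo: "pos (\<lambda>e. a e - (real k - 4 * card C))" "tr (\<lambda>e. a e - (real k - 4 * card C)) \<le> 1/4"
    by blast
  obtain f t where f: "f \<in> S" "0 < t"
    and up': "pos (\<lambda>e. real (4 * card C + 4 * k) + 4 - (a(f := a f + t)) e)"
      "tr (\<lambda>e. real (4 * card C + 4 * k) + 4 - (a(f := a f + t)) e) \<le> 1/4"
    and lo': "pos (\<lambda>e. (a(f := a f + t)) e - ((real k - 4 * card C) + 1))"
      "tr (\<lambda>e. (a(f := a f + t)) e - ((real k - 4 * card C) + 1)) \<le> 1/4"
    using barrier_step[OF up lo S nz] by metis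
  have supp: "{e. (a(f := a f + t)) e \<noteq> 0} \<subseteq> insert f {e. a e \<noteq> 0}" by auto
  have fin: "finite {e. a e \<noteq> 0}" using a(2) finite_S by (rule finite_subset)
  have "card {e. (a(f := a f + t)) e \<noteq> 0} \<le> card (insert f {e. a e \<noteq> 0})"
    using fin supp by (intro card_mono) auto
  also have "\<dots> \<le> Suc k" using fin a(3) by (simp add: card_insert_if)
  finally have "card {e. (a(f := a f + t)) e \<noteq> 0} \<le> Suc k" .
  moreover have "{e. (a(f := a f + t)) e \<noteq> 0} \<subseteq> S" using supp a(2) f(1) by blast
  moreover have "\<forall>e. 0 \<le> (a(f := a f + t)) e" using a(1) f(2) by (simp add: add_nonneg_nonneg)
  moreover have u: "real (4 * card C + 4 * Suc k) = real (4 * card C + 4 * k) + 4"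
    and l: "real (Suc k) - 4 * card C = (real k - 4 * card C) + 1" by auto
  ultimately show ?case unfolding u l using up' lo' by (intro exI[of _ "a(f := a f + t)"] conjI)
qed

text \<open>With \<open>d = card C\<close>, after \<open>8 * d\<close> steps the barriers stand at
  \<open>36 * d\<close> and \<open>4 * d\<close>. Dividing by their geometric mean
  \<open>12 * d\<close> splits the ratio 9 into a factor 3 on either side.\<close>

theorem sparse_approximation:
  assumes nz: "\<And>e. e \<in> S \<Longrightarrow> \<exists>x. b e x \<noteq> 0" and C: "finite C" "b ` S \<subseteq> span C" "0 < card C"
  obtains a where "\<And>e. 0 \<le> a e" "{e. a e \<noteq> 0} \<subseteq> S" "card {e. a e \<noteq> 0} \<le> 8 * card C"
    "\<And>x. P x x \<le> 3 * Q a x x" "\<And>x. Q a x x \<le> 3 * P x x"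
proof (cases "S = {}")
  case True
  then show thesis by (intro that[of "\<lambda>_. 0"]) (simp_all add: form_def)
next
  case False
  define d where "d = real (card C)"
  have d: "0 < d" using C(3) by (simp add: d_def)
  obtain a where a: "\<And>e. 0 \<le> a e" "{e. a e \<noteq> 0} \<subseteq> S" "card {e. a e \<noteq> 0} \<le> 8 * card C"
    and up: "pos (\<lambda>e. 36 * d - a e)" and lo: "pos (\<lambda>e. a e - 4 * d)"
    using barrier_iterate[OF False nz C, of "8 * card C"] by (auto simp: d_def)
  have "0 \<le> 36 * d * P x x - Q a x x" "0 \<le> Q a x x - 4 * d * P x x" for x
    using pos_nonneg[OF up, of x] pos_nonneg[OF lo, of x]
    by (simp_all add: form_minus form_const[of S b "36 * d"] form_const[of S b "4 * d"])
  moreover define a' where "a' = (\<lambda>e. 1 / (12 * d) * a e)"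
  moreover have "12 * d * Q a' x x = Q a x x" for x
    using d unfolding a'_def form_cmult by simp
  ultimately have "12 * d * P x x \<le> 12 * d * (3 * Q a' x x)" "12 * d * Q a' x x \<le> 12 * d * (3 * P x x)" for x
    by (simp_all add: mult.assoc mult.left_commute)
  moreover have "0 < 12 * d" using d by simp
  ultimately have "P x x \<le> 3 * Q a' x x" "Q a' x x \<le> 3 * P x x" for x
    by (blast intro: mult_left_le_imp_le)+
  then show thesis using a d by (intro that[of a']) (auto simp: a'_def)
qed

end

section \<open>Sparsifiers with dyadic weights\<close>

text \<open>Ordering the endpoints by identifier gives an undirected edge a sign, which disappears
  on squaring.\<close>

definition bdiff :: "nat set \<Rightarrow> (nat \<Rightarrow> real) \<Rightarrow> real" where
  "bdiff e x = x (Max e) - x (Min e)"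

lemma card_2_Min_Max:
  fixes e :: "nat set"
  assumes "card e = 2"
  shows "e = {Min e, Max e}" "Min e < Max e"
proof -
  obtain a b where e: "e = {a, b}" "a \<noteq> b" using assms by (meson card_2_iff)
  then show "e = {Min e, Max e}" "Min e < Max e" by (auto simp: min_def max_def)
qed

lemma quadratic_form_laplacian:
  assumes "simple_graph V E"
  shows "quadratic_form V (laplacian E w) x = (\<Sum>e\<in>E. w e * (bdiff e x)\<^sup>2)"
proof -
  have V: "finite V" and E: "\<And>e. e \<in> E \<Longrightarrow> e \<subseteq> V \<and> card e = 2"
    using assms by (auto simp: simple_graph_def)
  have "finite E" using E V by (intro finite_subset[of E "Pow V"]) auto
  \<comment> \<open>The Laplacian of the single edge \<open>e\<close> with weight 1.\<close>
  define K :: "nat set \<Rightarrow> nat \<Rightarrow> nat \<Rightarrow> real"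
    where "K e u v = (if u = v then of_bool (u \<in> e) else - of_bool ({u, v} = e))" for e u v
  have lap: "laplacian E w u v = (\<Sum>e\<in>E. w e * K e u v)" for u v
  proof (cases "u = v")
    case True
    have "{u} \<notin> E" using E by force
    moreover have "weighted_degree E w u = (\<Sum>e\<in>E. w e * of_bool (u \<in> e))"
      unfolding weighted_degree_def using \<open>finite E\<close> by (intro sum.mono_neutral_cong_left) auto
    ultimately show ?thesis
      using True by (simp add: laplacian_def degree_matrix_def adjacency_matrix_def K_def)
  next
    case False
    have "(\<Sum>e\<in>E. w e * K e u v) = (\<Sum>e\<in>E. if e = {u, v} then - w e else 0)"
      using False by (intro sum.cong) (auto simp: K_def)
    then show ?thesis
      using False \<open>finite E\<close> by (simp add: laplacian_def degree_matrix_def adjacency_matrix_def)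
  qed
  have inner: "(\<Sum>u\<in>V. \<Sum>v\<in>V. x u * K e u v * x v) = (bdiff e x)\<^sup>2" if e: "e \<in> E" for e
  proof -
    let ?a = "Min e" and ?b = "Max e"
    have eq: "e = {?a, ?b}" and ab: "?a < ?b" using card_2_Min_Max E e by blast+
    have sub: "e \<subseteq> V" using E e by blast
    have "?a \<in> e" "?b \<in> e" "{?a, ?b} = e" "{?b, ?a} = e" using eq by blast+
    then have K: "K e ?a ?a = 1" "K e ?b ?b = 1" "K e ?a ?b = -1" "K e ?b ?a = -1"
      using ab unfolding K_def by auto
    have "(\<Sum>u\<in>V. \<Sum>v\<in>V. x u * K e u v * x v) = (\<Sum>u\<in>V. \<Sum>v\<in>e. x u * K e u v * x v)"
      using V sub by (intro sum.cong refl sum.mono_neutral_right) (auto simp: K_def)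
    also have "\<dots> = (\<Sum>u\<in>e. \<Sum>v\<in>e. x u * K e u v * x v)"
      using V sub by (intro sum.mono_neutral_right) (auto simp: K_def intro!: sum.neutral)
    also have "\<dots> = (\<Sum>u\<in>{?a, ?b}. \<Sum>v\<in>{?a, ?b}. x u * K e u v * x v)"
      by (subst (1 2) eq) (rule refl)
    also have "\<dots> = x ?a * K e ?a ?a * x ?a + x ?a * K e ?a ?b * x ?b
        + (x ?b * K e ?b ?a * x ?a + x ?b * K e ?b ?b * x ?b)"
      using ab by simp
    also have "\<dots> = (bdiff e x)\<^sup>2"
      unfolding K by (simp add: bdiff_def power2_eq_square algebra_simps)
    finally show ?thesis .
  qed
  have "quadratic_form V (laplacian E w) x = (\<Sum>u\<in>V. \<Sum>v\<in>V. \<Sum>e\<in>E. w e * (x u * K e u v * x v))"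
    unfolding quadratic_form_def lap
    by (simp add: sum_distrib_left sum_distrib_right mult_ac)
  also have "\<dots> = (\<Sum>u\<in>V. \<Sum>e\<in>E. \<Sum>v\<in>V. w e * (x u * K e u v * x v))"
    by (intro sum.cong refl sum.swap)
  also have "\<dots> = (\<Sum>e\<in>E. w e * (\<Sum>u\<in>V. \<Sum>v\<in>V. x u * K e u v * x v))"
    unfolding sum_distrib_left by (rule sum.swap)
  finally show ?thesis by (simp add: inner)
qed

text \<open>Graphs whose weights are powers of two: the pair \<open>(e, i)\<close> stands for an edge \<open>e\<close> of
  weight \<open>2\<^sup>i\<close>.\<close>

type_synonym pgraph = "(nat set \<times> int) set"

definition energy :: "pgraph \<Rightarrow> (nat \<Rightarrow> real) \<Rightarrow> real" where
  "energy X x = (\<Sum>(e, i)\<in>X. 2 powr i * (bdiff e x)\<^sup>2)"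

definition pgraph :: "nat set \<Rightarrow> pgraph \<Rightarrow> bool" where
  "pgraph V X \<longleftrightarrow> finite X \<and> inj_on fst X \<and> (\<forall>e\<in>fst ` X. e \<subseteq> V \<and> card e = 2)"

text \<open>With the reweighted form \<open>Q a\<close>, rounding down costs a factor 2 and dropping
  weights reduced below 1/6 costs a sixth of the energy. So
  \<open>X \<le> 3 * (2 * Y + X / 6)\<close> in energies, which gives 12. Kept weights shrink to no
  less than 1/6 before rounding, above \<open>2 powr -4\<close>, hence the 4 in the last clause,
  which limits the downward drift of exponents.\<close>

definition sparsifies :: "nat set \<Rightarrow> pgraph \<Rightarrow> pgraph \<Rightarrow> bool" where
  "sparsifies V X Y \<longleftrightarrow> pgraph V Y \<and> fst ` Y \<subseteq> fst ` X \<and> card Y \<le> 8 * card V \<and>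
     (\<forall>x. energy X x \<le> 12 * energy Y x \<and> energy Y x \<le> 3 * energy X x) \<and>
     (\<forall>e i j. (e, i) \<in> X \<longrightarrow> (e, j) \<in> Y \<longrightarrow> i - 4 \<le> j)"

lemma energy_nonneg: "0 \<le> energy X x"
  unfolding energy_def by (intro sum_nonneg) auto

lemma powr_floor_log:
  assumes "0 < (w::real)"
  shows "2 powr \<lfloor>log 2 w\<rfloor> \<le> w" "w \<le> 2 * 2 powr \<lfloor>log 2 w\<rfloor>"
proof -
  have "2 powr \<lfloor>log 2 w\<rfloor> \<le> 2 powr log 2 w" by (intro powr_mono) auto
  then show "2 powr \<lfloor>log 2 w\<rfloor> \<le> w" using assms by simp
  have "2 powr log 2 w \<le> 2 powr (1 + \<lfloor>log 2 w\<rfloor>)" by (intro powr_mono) linarith+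
  then show "w \<le> 2 * 2 powr \<lfloor>log 2 w\<rfloor>" using assms by (simp add: powr_add)
qed

lemma sparsifies_exists:
  assumes X: "pgraph V X" and V: "finite V" "V \<noteq> {}"
  shows "\<exists>Y. sparsifies V X Y"
proof -
  \<comment> \<open>The square root of the weight is put into the functional, so that
    \<open>P\<close> is the energy.\<close>
  define b :: "nat set \<times> int \<Rightarrow> (nat \<Rightarrow> real) \<Rightarrow> real"
    where "b p x = 2 powr (real_of_int (snd p) / 2) * bdiff (fst p) x" for p x
  \<comment> \<open>The coordinate functionals at the vertices span all edge functionals; this
    bounds the rank by \<open>card V\<close>.\<close>
  define C :: "((nat \<Rightarrow> real) \<Rightarrow> real) set" where "C = (\<lambda>v x. x v) ` V"
  have finX: "finite X" and injX: "inj_on fst X" and E: "\<And>p. p \<in> X \<Longrightarrow> fst p \<subseteq> V \<and> card (fst p) = 2"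
    using X by (auto simp: pgraph_def)
  interpret functionals X b
  proof (rule functionals.intro)
    show "linear (b p)" if "p \<in> X" for p
      by (auto simp: linear_iff b_def bdiff_def scaleR_fun_def algebra_simps)
  qed (rule finX)
  have sq: "b p x * b p x = 2 powr real_of_int (snd p) * (bdiff (fst p) x)\<^sup>2" for p x
    by (simp add: b_def power2_eq_square powr_add[symmetric])
  have P: "P x x = energy X x" for x
    by (simp add: form_def energy_def sq case_prod_unfold)
  have nz: "\<exists>x. b p x \<noteq> 0" if "p \<in> X" for p
  proof -
    have "Min (fst p) < Max (fst p)" using card_2_Min_Max E[OF that] by blast
    then have "b p (\<lambda>v. of_bool (v = Max (fst p))) \<noteq> 0" by (simp add: b_def bdiff_def)
    then show ?thesis by blast
  qed
  have bC: "b ` X \<subseteq> span C"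
  proof
    fix g assume "g \<in> b ` X"
    then obtain p where p: "p \<in> X" "g = b p" by blast
    have "{Min (fst p), Max (fst p)} \<subseteq> V" using E[OF p(1)] card_2_Min_Max(1)[of "fst p"] by simp
    then have "(\<lambda>x. x (Max (fst p))) \<in> span C" "(\<lambda>x. x (Min (fst p))) \<in> span C"
      by (auto simp: C_def intro!: span_base)
    then have "2 powr (real_of_int (snd p) / 2) *\<^sub>R ((\<lambda>x. x (Max (fst p))) - (\<lambda>x. x (Min (fst p)))) \<in> span C"
      by (intro span_scale span_diff)
    also have "2 powr (real_of_int (snd p) / 2) *\<^sub>R ((\<lambda>x. x (Max (fst p))) - (\<lambda>x. x (Min (fst p)))) = g"
      by (simp add: p(2) b_def bdiff_def scaleR_fun_def fun_eq_iff)
    finally show "g \<in> span C" .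
  qed
  have C: "finite C" "0 < card C" "card C \<le> card V"
    using V by (auto simp: C_def card_gt_0_iff intro: card_image_le)
  obtain a where a: "\<And>p. 0 \<le> a p" "{p. a p \<noteq> 0} \<subseteq> X" "card {p. a p \<noteq> 0} \<le> 8 * card C"
    and lo: "\<And>x. P x x \<le> 3 * Q a x x" and up: "\<And>x. Q a x x \<le> 3 * P x x"
    using sparse_approximation[OF nz C(1) bC C(2)] by blast
  \<comment> \<open>Discarded edges carry at most a sixth of the energy of \<open>X\<close>; kept
    ones have exponents bounded from below.\<close>
  define W where "W = {p \<in> X. 1/6 \<le> a p}"
  define g where "g p = (fst p, \<lfloor>log 2 (a p * 2 powr real_of_int (snd p))\<rfloor>)" for p :: "nat set \<times> int"
  have W: "W \<subseteq> X" "finite W" using finX by (auto simp: W_def)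
  have injg: "inj_on g W"
    using inj_on_subset[OF injX W(1)] by (auto simp: inj_on_def g_def)
  have fst_g: "fst ` g ` W = fst ` W" by (auto simp: g_def image_image)
  have pos: "0 < a p * 2 powr real_of_int (snd p)" if "p \<in> W" for p using that by (auto simp: W_def)
  have energy_g: "energy (g ` W) x = (\<Sum>p\<in>W. 2 powr \<lfloor>log 2 (a p * 2 powr real_of_int (snd p))\<rfloor> * (bdiff (fst p) x)\<^sup>2)" for x
    unfolding energy_def sum.reindex[OF injg] by (simp add: g_def)
  have Qa: "Q a x x = (\<Sum>p\<in>X. a p * 2 powr real_of_int (snd p) * (bdiff (fst p) x)\<^sup>2)" for x
    by (simp add: form_def mult.assoc sq)
  have upper: "energy (g ` W) x \<le> 3 * energy X x" for x
  proof -
    have "energy (g ` W) x \<le> (\<Sum>p\<in>W. a p * 2 powr real_of_int (snd p) * (bdiff (fst p) x)\<^sup>2)"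
      unfolding energy_g using powr_floor_log(1)[OF pos] by (intro sum_mono mult_right_mono) auto
    also have "\<dots> \<le> Q a x x"
      unfolding Qa using W finX a(1) by (intro sum_mono2) auto
    also have "\<dots> \<le> 3 * energy X x" using up[of x] P[of x] by simp
    finally show ?thesis .
  qed
  have "Q a x x \<le> (\<Sum>p\<in>W. a p * 2 powr real_of_int (snd p) * (bdiff (fst p) x)\<^sup>2) + energy X x / 6" for x
  proof -
    have "Q a x x = (\<Sum>p\<in>W. a p * 2 powr real_of_int (snd p) * (bdiff (fst p) x)\<^sup>2)
        + (\<Sum>p\<in>X - W. a p * 2 powr real_of_int (snd p) * (bdiff (fst p) x)\<^sup>2)"
      unfolding Qa using W finX by (simp add: sum.subset_diff[of W X] add.commute)
    also have "(\<Sum>p\<in>X - W. a p * 2 powr real_of_int (snd p) * (bdiff (fst p) x)\<^sup>2)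
        \<le> (\<Sum>p\<in>X - W. 1/6 * (2 powr real_of_int (snd p) * (bdiff (fst p) x)\<^sup>2))"
      unfolding mult.assoc by (intro sum_mono mult_right_mono) (auto simp: W_def)
    also have "\<dots> \<le> (\<Sum>p\<in>X. 1/6 * (2 powr real_of_int (snd p) * (bdiff (fst p) x)\<^sup>2))"
      using finX by (intro sum_mono2) auto
    also have "\<dots> = energy X x / 6"
      by (simp add: energy_def case_prod_unfold sum_divide_distrib)
    finally show ?thesis by simp
  qed
  moreover have "(\<Sum>p\<in>W. a p * 2 powr real_of_int (snd p) * (bdiff (fst p) x)\<^sup>2) \<le> 2 * energy (g ` W) x" for x
    unfolding energy_g sum_distrib_left mult.assoc[symmetric]
    using powr_floor_log(2)[OF pos] by (intro sum_mono mult_right_mono) auto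
  ultimately have half: "Q a x x \<le> 2 * energy (g ` W) x + energy X x / 6" for x
    by (rule order_trans[OF _ add_right_mono])
  have lower: "energy X x \<le> 12 * energy (g ` W) x" for x
    using half[of x] lo[of x] P[of x] by simp
  have "card (g ` W) \<le> card W" using W(2) by (rule card_image_le)
  also have "\<dots> \<le> card {p. a p \<noteq> 0}"
    using finite_subset[OF a(2) finX] by (intro card_mono) (auto simp: W_def)
  finally have card: "card (g ` W) \<le> 8 * card V" using a(3) C(3) by simp
  have expo: "i - 4 \<le> j" if i: "(e, i) \<in> X" and j: "(e, j) \<in> g ` W" for e i j
  proof -
    obtain p where p: "p \<in> W" "(e, j) = g p" using j by blast
    then have "p = (e, i)" using injX i W(1) by (auto simp: g_def inj_on_def)
    then have j: "j = \<lfloor>log 2 (a p * 2 powr i)\<rfloor>" "1/6 \<le> a p" using p by (auto simp: g_def W_def)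
    have "2 powr (i - 4) = 2 powr i * (1/16)" by (simp add: powr_diff)
    also have "\<dots> \<le> 2 powr i * a p" using j(2) by (intro mult_left_mono) auto
    finally have "2 powr real_of_int (i - 4) \<le> a p * 2 powr i" by (simp add: mult.commute)
    then have "real_of_int (i - 4) \<le> log 2 (a p * 2 powr i)"
      using j(2) by (subst le_log_iff) auto
    then show ?thesis unfolding j(1) by (simp add: le_floor_iff)
  qed
  have "pgraph V (g ` W)"
    using W E inj_on_subset[OF injX W(1)] by (auto simp: pgraph_def inj_on_def g_def)
  then have "sparsifies V X (g ` W)"
    unfolding sparsifies_def fst_g using upper lower card expo W(1) by blast
  then show ?thesis by blast
qed

section \<open>The protocol\<close>

text \<open>\<open>lastin\<close> keeps the first hop until it is forwarded, \<open>buf c a\<close>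
  is the second-hop inbox for child \<open>c\<close> and slot \<open>a\<close>, and entry
  \<open>i\<close> of \<open>acc\<close> is the finished sparsifier of weight class
  \<open>i\<close>.\<close>

record node_state =
  inp :: local_input
  nodes :: "nat set"
  cur :: pgraph
  lastin :: inbox
  buf :: "nat \<Rightarrow> nat \<Rightarrow> inbox"
  acc :: "pgraph list"
  fin :: bool

text \<open>One operation per round, the same at all nodes. \<open>Merge\<close> occupies a round in
  which only empty messages are sent.\<close>

datatype operation = Start nat | Hop1 nat | Hop2 nat nat nat | Merge nat

text \<open>Identifiers have gaps; ranks give tree positions that every node computes by itself once
  it knows the node set.\<close>

definition id_rank :: "nat set \<Rightarrow> nat \<Rightarrow> nat" where
  "id_rank V v = card {u \<in> V. u < v}"

definition node_of_rank :: "nat set \<Rightarrow> nat \<Rightarrow> nat" where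
  "node_of_rank V = inv_into V (id_rank V)"

lemma bij_betw_id_rank:
  assumes "finite V"
  shows "bij_betw (id_rank V) V {..<card V}"
proof -
  have less: "id_rank V u < id_rank V v" if "u \<in> V" "u < v" for u v
    unfolding id_rank_def using assms that by (intro psubset_card_mono) auto
  have inj: "inj_on (id_rank V) V"
    by (rule inj_onI) (metis less less_irrefl linorder_neqE_nat)
  have "id_rank V ` V \<subseteq> {..<card V}"
    unfolding id_rank_def using assms by (auto intro!: psubset_card_mono)
  then have "id_rank V ` V = {..<card V}"
    using card_image[OF inj] by (intro card_subset_eq) auto
  then show ?thesis using inj by (simp add: bij_betw_def)
qed

text \<open>The edge in slot \<open>(a, q)\<close> is handed to the relay \<open>q\<close> in hop
  \<open>a\<close>; eight hops to all of \<open>V\<close> leave room for \<open>8 * card V\<close>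
  edges.\<close>

definition slots :: "nat set \<Rightarrow> pgraph \<Rightarrow> nat \<Rightarrow> nat \<Rightarrow> (nat set \<times> int) option" where
  "slots V X = (SOME f. {p. \<exists>a<8. \<exists>q\<in>V. f a q = Some p} = X)"

lemma slots:
  assumes "finite V" "finite X" "card X \<le> 8 * card V"
  shows "{p. \<exists>a<8. \<exists>q\<in>V. slots V X a q = Some p} = X"
proof -
  have "card X \<le> card ({..<8::nat} \<times> V)" using assms by (simp add: card_cartesian_product)
  then obtain h where h: "h ` X \<subseteq> {..<8::nat} \<times> V" "inj_on h X"
    using card_le_inj[of X "{..<8::nat} \<times> V"] assms by auto
  define f where "f a q = (if (a, q) \<in> h ` X then Some (inv_into X h (a, q)) else None)" for a q
  have "{p. \<exists>a<8. \<exists>q\<in>V. f a q = Some p} = X"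
  proof (intro set_eqI iffI)
    fix p assume "p \<in> X"
    moreover obtain a q where aq: "h p = (a, q)" by force
    ultimately have "a < 8" "q \<in> V" "f a q = Some p"
      using h inv_into_f_f[OF h(2) \<open>p \<in> X\<close>] by (force simp: f_def)+
    then show "p \<in> {p. \<exists>a<8. \<exists>q\<in>V. f a q = Some p}" by blast
  qed (auto simp: f_def h(2) split: if_splits)
  then show ?thesis
    unfolding slots_def by (rule someI[of "\<lambda>f. {p. \<exists>a<8. \<exists>q\<in>V. f a q = Some p} = X"])
qed

definition sparsifier :: "nat set \<Rightarrow> pgraph \<Rightarrow> pgraph" where
  "sparsifier V X = (SOME Y. sparsifies V X Y)"

lemma sparsifier: "pgraph V X \<Longrightarrow> finite V \<Longrightarrow> V \<noteq> {} \<Longrightarrow> sparsifies V X (sparsifier V X)"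
  unfolding sparsifier_def by (rule someI_ex[OF sparsifies_exists])

text \<open>Enforces the bit bound unconditionally, in every round and for every history; the
  messages that matter for correctness are short enough to pass unchanged.\<close>

definition clip :: "nat \<Rightarrow> message \<Rightarrow> message" where
  "clip b m = (if length m \<le> b then m else [])"

text \<open>Nodes are arranged by rank as the nodes of \<open>l\<close> levels of a \<open>k\<close>-ary tree. In phase
  \<open>j < l\<close> every node collects the graphs held by its children and sparsifies their union; in
  phase \<open>l\<close> every node collects the graph held by the node of rank 0. An edge
  of a graph reaches its destination in two hops: the holder spreads its graph over the clique, eight
  edges per node, and the intermediate nodes forward these edges. \<open>M\<close> is the set of pairs that
  can be encoded by \<open>enc\<close> in \<open>b\<close> bits.\<close>

locale protocol =
  fixes k l b :: nat and M :: pgraph and enc :: "nat set \<times> int \<Rightarrow> message"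
begin

text \<open>The parent of rank \<open>m\<close> is \<open>m div k\<close> at every level, so rank 0
  is its own child and all nodes take part in all levels. For \<open>j = l\<close> the only child is
  rank 0, which turns the phase into a broadcast.\<close>

definition source :: "nat set \<Rightarrow> nat \<Rightarrow> nat \<Rightarrow> nat \<Rightarrow> nat option" where
  "source V j v c =
    (let m = if j < l then id_rank V v * k + c else c
     in if m < card V \<and> (j < l \<or> c = 0) then Some (node_of_rank V m) else None)"

fun send_op :: "operation \<Rightarrow> node_state \<Rightarrow> nat \<Rightarrow> message" where
  "send_op (Start i) s v = (if \<exists>(e, w)\<in>incident_edges (inp s). 2 ^ i \<le> w then [True] else [])"
| "send_op (Hop1 a) s v = (case slots (nodes s) (cur s) a v of None \<Rightarrow> [] | Some p \<Rightarrow> enc p)"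
| "send_op (Hop2 j c a) s v =
    (case source (nodes s) j v c of None \<Rightarrow> [] | Some u \<Rightarrow>
      (case lastin s u of None \<Rightarrow> [] | Some m \<Rightarrow> m))"
| "send_op (Merge j) s v = []"

text \<open>Decoding is a search through \<open>M\<close>, since \<open>enc\<close> is not yet
  assumed to be injective.\<close>

definition received :: "node_state \<Rightarrow> pgraph" where
  "received s = {p \<in> M. \<exists>c<k. \<exists>a<8. \<exists>q. buf s c a q = Some (enc p)}"

text \<open>The smaller endpoint alone enters an edge into the tree. The exponent 0 measures weights
  in units of \<open>2 ^ i\<close>, which keeps the codes independent of \<open>U\<close>;
  \<open>out_weight\<close> restores the factor.\<close>

definition owned :: "nat \<Rightarrow> local_input \<Rightarrow> pgraph" where
  "owned i x = {(e, 0) |e w. (e, w) \<in> incident_edges x \<and> Min e = own_id x \<and> 2 ^ i \<le> w \<and> w < 2 ^ Suc i}"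

text \<open>The inbox given here includes the node's own message, so \<open>dom ib\<close> is the
  whole node set and the termination test also covers the node's own edges.\<close>

fun update_op :: "operation \<Rightarrow> node_state \<Rightarrow> inbox \<Rightarrow> node_state" where
  "update_op (Start i) s ib =
    s\<lparr>nodes := dom ib, cur := owned i (inp s), fin := fin s \<or> (\<forall>u. ib u \<noteq> Some [True])\<rparr>"
| "update_op (Hop1 a) s ib = s\<lparr>lastin := ib\<rparr>"
| "update_op (Hop2 j c a) s ib = s\<lparr>buf := (buf s)(c := (buf s c)(a := ib))\<rparr>"
| "update_op (Merge j) s ib =
    (if j < l then s\<lparr>cur := sparsifier (nodes s) (received s)\<rparr>
     else s\<lparr>acc := acc s @ [received s]\<rparr>)"

definition gather :: "nat \<Rightarrow> (nat \<times> nat) list \<Rightarrow> operation list" where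
  "gather j cas = concat (map (\<lambda>(c, a). [Hop1 a, Hop2 j c a]) cas)"

definition phase :: "nat \<Rightarrow> operation list" where
  "phase j = gather j (List.product [0..<k] [0..<8]) @ [Merge j]"

definition period :: "nat \<Rightarrow> operation list" where
  "period i = Start i # concat (map phase [0..<Suc l])"

text \<open>The \<open>16 * k\<close> rounds are two hops for each of \<open>k\<close> children and
  8 slots; the added ones are the \<open>Merge\<close> and \<open>Start\<close> rounds.\<close>

definition period_length :: nat where
  "period_length = 1 + Suc l * (16 * k + 1)"

lemma length_gather: "length (gather j cas) = 2 * length cas"
  unfolding gather_def by (induction cas) auto

lemma length_period: "length (period i) = period_length"
proof -
  have "length (phase j) = 16 * k + 1" for j
    by (simp add: phase_def length_gather)
  then have "length (concat (map phase js)) = length js * (16 * k + 1)" for js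
    by (induction js) auto
  then show ?thesis by (simp add: period_def period_length_def del: upt_Suc)
qed

definition op_at :: "nat \<Rightarrow> operation" where
  "op_at t = period (t div period_length) ! (t mod period_length)"

text \<open>The state is replayed from the history, newest inbox first, so that
  \<open>length h\<close> is the round number. The model delivers nothing from a node to itself;
  inserting that message lets a node be its own relay and its own child.\<close>

primrec rev_state :: "local_input \<Rightarrow> inbox list \<Rightarrow> node_state" where
  "rev_state x [] = \<lparr>inp = x, nodes = {}, cur = {}, lastin = (\<lambda>_. None), buf = (\<lambda>_ _ _. None),
                  acc = [], fin = False\<rparr>"
| "rev_state x (ib # h) =
    (let s = rev_state x h; opn = op_at (length h)
     in update_op opn s (ib(own_id x := Some (clip b (send_op opn s (own_id x))))))"

definition state :: "local_input \<Rightarrow> inbox list \<Rightarrow> node_state" where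
  "state x h = rev_state x (rev h)"

definition out_edges :: "pgraph list \<Rightarrow> nat set set" where
  "out_edges gs = (\<Union>i<length gs. fst ` (gs ! i))"

definition out_weight :: "pgraph list \<Rightarrow> nat set \<Rightarrow> real" where
  "out_weight gs e = (\<Sum>i<length gs. \<Sum>p\<in>{p \<in> gs ! i. fst p = e}. 2 powr (real_of_int (snd p) + i))"

definition send_message :: "local_input \<Rightarrow> inbox list \<Rightarrow> nat \<Rightarrow> message" where
  "send_message x h v = clip b (send_op (op_at (length h)) (state x h) v)"

definition decision :: "local_input \<Rightarrow> inbox list \<Rightarrow> (nat set set \<times> (nat set \<Rightarrow> real)) option" where
  "decision x h = (if fin (state x h) then Some (out_edges (acc (state x h)), out_weight (acc (state x h)))
                   else None)"

section \<open>Synchronous execution of all nodes\<close>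

definition step :: "nat set \<Rightarrow> operation \<Rightarrow> (nat \<Rightarrow> node_state) \<Rightarrow> nat \<Rightarrow> node_state" where
  "step V opn \<sigma> v =
     update_op opn (\<sigma> v) (\<lambda>u. if u \<in> V then Some (clip b (send_op opn (\<sigma> u) v)) else None)"

primrec config :: "nat set \<Rightarrow> (nat \<Rightarrow> local_input) \<Rightarrow> nat \<Rightarrow> nat \<Rightarrow> node_state" where
  "config V inps 0 = (\<lambda>v. rev_state (inps v) [])"
| "config V inps (Suc t) = step V (op_at t) (config V inps t)"

lemma length_history: "length (history A V inps t v) = t"
  by (induction t) auto

text \<open>Each node's replay of its own history agrees with the global execution. Only the
  behaviour on the inputs \<open>inps v\<close> is prescribed, because the algorithm reads its
  parameters off the input.\<close>

lemma state_history:
  assumes snd: "\<And>v h. v \<in> V \<Longrightarrow> send A (inps v) h = send_message (inps v) h"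
    and own: "\<And>v. v \<in> V \<Longrightarrow> own_id (inps v) = v"
    and "v \<in> V"
  shows "state (inps v) (history A V inps t v) = config V inps t v"
  using \<open>v \<in> V\<close>
proof (induction t arbitrary: v)
  case 0
  then show ?case by (simp add: state_def)
next
  case (Suc t)
  have rev_state: "rev_state (inps v) (rev (history A V inps t v)) = config V inps t v" if "v \<in> V" for v
    using Suc.IH[OF that] by (simp add: state_def)
  have msg: "send A (inps u) (history A V inps t u) v
      = clip b (send_op (op_at t) (config V inps t u) v)" if "u \<in> V" for u v
    using Suc.IH[OF that] by (simp add: snd[OF that] send_message_def length_history)
  have "(\<lambda>u. if u \<in> V \<and> u \<noteq> v then Some (send A (inps u) (history A V inps t u) v) else None)
      (v := Some (clip b (send_op (op_at t) (config V inps t v) v)))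
      = (\<lambda>u. if u \<in> V then Some (clip b (send_op (op_at t) (config V inps t u) v)) else None)"
    using Suc.prems msg by (auto simp: fun_eq_iff)
  then show ?case
    using Suc.prems by (simp add: state_def own length_history rev_state step_def Let_def)
qed

lemma config_add:
  "config V inps (t + m) = fold (step V) (map op_at [t..<t + m]) (config V inps t)"
  by (induction m) auto

lemma map_op_at_period: "map op_at [i * period_length..<i * period_length + period_length] = period i"
proof (rule nth_equalityI)
  show "length (map op_at [i * period_length..<i * period_length + period_length]) = length (period i)"
    by (simp add: length_period)
qed (simp add: op_at_def)

lemma config_period:
  "config V inps (Suc i * period_length) = fold (step V) (period i) (config V inps (i * period_length))"
  using config_add[of V inps "i * period_length" period_length]
  unfolding map_op_at_period by (simp add: add.commute)

lemma op_at_period_start: "op_at (i * period_length) = Start i"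
proof -
  have "0 < period_length" by (simp add: period_length_def)
  then show ?thesis by (simp add: op_at_def period_def)
qed

text \<open>Only \<open>Start\<close> can set \<open>fin\<close>; locating its rounds excludes
  premature outputs.\<close>

lemma op_at_Start:
  assumes "op_at t = Start i"
  shows "t = i * period_length"
proof -
  have pos: "0 < period_length" by (simp add: period_length_def)
  define q where "q = t div period_length"
  have t: "op_at t = period q ! (t mod period_length)" by (simp add: op_at_def q_def)
  have tail: "Start i' \<notin> set (concat (map phase js))" for i' js
    by (auto simp: phase_def gather_def)
  have "t mod period_length = 0"
  proof (rule ccontr)
    assume "t mod period_length \<noteq> 0"
    then obtain m where m: "t mod period_length = Suc m" using not0_implies_Suc by blast
    then have "Suc m < length (period q)" using pos by (metis length_period mod_less_divisor)
    then have "m < length (concat (map phase [0..<Suc l]))"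
      by (simp add: period_def del: upt_Suc)
    then have "op_at t \<in> set (concat (map phase [0..<Suc l]))"
      unfolding t m period_def nth_Cons_Suc by (rule nth_mem)
    then show False using tail assms by metis
  qed
  then show ?thesis using assms unfolding t period_def q_def by (auto simp: mult.commute)
qed

end

text \<open>Kept apart from \<open>protocol\<close> because the program has to be defined on every
  local input, whereas these properties hold only for suitable parameters. Codes are nonempty since
  the empty message means that no edge is sent.\<close>

locale encoding_protocol = protocol +
  assumes enc_inj: "inj_on enc M" and enc_nonempty: "p \<in> M \<Longrightarrow> enc p \<noteq> []"
    and enc_length: "p \<in> M \<Longrightarrow> length (enc p) \<le> b" and b_pos: "1 \<le> b"
    and k_pos: "0 < k"
begin

section \<open>Correctness of the two-hop transfers and of termination\<close>

definition forwarded :: "nat set \<Rightarrow> (nat \<Rightarrow> pgraph) \<Rightarrow> nat \<Rightarrow> nat \<Rightarrow> nat \<Rightarrow> nat \<Rightarrow> inbox" where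
  "forwarded V g j v c a q = (if q \<in> V then
     Some (case source V j v c of None \<Rightarrow> [] | Some u \<Rightarrow>
       (case slots V (g u) a q of None \<Rightarrow> [] | Some p \<Rightarrow> enc p)) else None)"

definition sendable :: "nat set \<Rightarrow> pgraph \<Rightarrow> bool" where
  "sendable V X \<longleftrightarrow> finite X \<and> card X \<le> 8 * card V \<and> X \<subseteq> M"

lemma slots_in:
  assumes "finite V" "sendable V X" "a < 8" "q \<in> V" "slots V X a q = Some p"
  shows "p \<in> X"
  using slots[of V X] assms unfolding sendable_def by blast

lemma source_in:
  assumes "finite V" "source V j v c = Some u"
  shows "u \<in> V"
proof -
  obtain m where "m < card V" "u = node_of_rank V m"
    using assms(2) by (auto simp: source_def Let_def split: if_splits)
  then show ?thesis
    using bij_betw_id_rank[OF assms(1)] unfolding node_of_rank_def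
    by (metis bij_betw_imp_surj_on inv_into_into lessThan_iff)
qed

text \<open>A pair of hops changes only \<open>lastin\<close> and one buffer cell, and the new
  content of that cell is determined by the graphs \<open>g\<close>, which stay fixed while
  gathering.\<close>

lemma fold_gather:
  assumes V: "finite V"
    and cur: "\<And>u. u \<in> V \<Longrightarrow> nodes (\<sigma> u) = V \<and> cur (\<sigma> u) = g u \<and> sendable V (g u)"
    and "\<And>c a. (c, a) \<in> set cas \<Longrightarrow> a < 8"
  shows "\<forall>v\<in>V. inp (fold (step V) (gather j cas) \<sigma> v) = inp (\<sigma> v) \<and>
    nodes (fold (step V) (gather j cas) \<sigma> v) = V \<and>
    cur (fold (step V) (gather j cas) \<sigma> v) = g v \<and>
    acc (fold (step V) (gather j cas) \<sigma> v) = acc (\<sigma> v) \<and>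
    (\<forall>(c, a)\<in>set cas. buf (fold (step V) (gather j cas) \<sigma> v) c a = forwarded V g j v c a)"
  using assms(3)
proof (induction cas rule: rev_induct)
  case Nil
  then show ?case using cur by (simp add: gather_def)
next
  case (snoc x cas)
  obtain c a where x: "x = (c, a)" by force
  have a: "a < 8" using snoc.prems x by auto
  define \<tau> where "\<tau> = fold (step V) (gather j cas) \<sigma>"
  have IH: "\<forall>v\<in>V. inp (\<tau> v) = inp (\<sigma> v) \<and> nodes (\<tau> v) = V \<and> cur (\<tau> v) = g v \<and>
    acc (\<tau> v) = acc (\<sigma> v) \<and>
    (\<forall>(c, a)\<in>set cas. buf (\<tau> v) c a = forwarded V g j v c a)"
    unfolding \<tau>_def using snoc by auto
  have split: "fold (step V) (gather j (cas @ [x])) \<sigma> = step V (Hop2 j c a) (step V (Hop1 a) \<tau>)"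
    by (simp add: gather_def \<tau>_def x)
  define msg where "msg u q = (case slots V (g u) a q of None \<Rightarrow> [] | Some p \<Rightarrow> enc p)" for u q
  have short: "length (msg u q) \<le> b" if "u \<in> V" "q \<in> V" for u q
  proof (cases "slots V (g u) a q")
    case (Some p)
    have s: "sendable V (g u)" using cur[OF that(1)] by blast
    then have "p \<in> M" using slots_in[OF V s a that(2) Some] by (auto simp: sendable_def)
    then show ?thesis using Some enc_length by (simp add: msg_def)
  qed (simp add: msg_def)
  have hop1: "step V (Hop1 a) \<tau> q = (\<tau> q)\<lparr>lastin := (\<lambda>u. if u \<in> V then Some (msg u q) else None)\<rparr>"
    if "q \<in> V" for q
    using IH short that by (auto simp: step_def msg_def[symmetric] clip_def fun_eq_iff
        intro!: arg_cong[where f = "\<lambda>x. lastin_update x (\<tau> q)"])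
  have hop2: "send_op (Hop2 j c a) (step V (Hop1 a) \<tau> q) v
      = (case source V j v c of None \<Rightarrow> [] | Some u \<Rightarrow> msg u q)" if "q \<in> V" for q v
    using IH that source_in[OF V] by (auto simp: hop1[OF that] split: option.split)
  have "(\<lambda>q. if q \<in> V then Some (clip b (send_op (Hop2 j c a) (step V (Hop1 a) \<tau> q) v)) else None)
      = forwarded V g j v c a" for v
    using short source_in[OF V]
    by (auto simp: fun_eq_iff hop2 forwarded_def msg_def[symmetric] clip_def
        simp del: send_op.simps split: option.split)
  then have "step V (Hop2 j c a) (step V (Hop1 a) \<tau>) v
      = update_op (Hop2 j c a) (step V (Hop1 a) \<tau> v) (forwarded V g j v c a)" for v
    by (simp only: step_def[of V "Hop2 j c a"])
  moreover have "buf (\<tau> v) c' a' = forwarded V g j v c' a'" if "v \<in> V" "(c', a') \<in> set cas" for v c' a'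
    using IH that by blast
  ultimately show ?case
    unfolding split using IH by (auto simp: hop1 x)
qed

definition collected :: "nat set \<Rightarrow> (nat \<Rightarrow> pgraph) \<Rightarrow> nat \<Rightarrow> nat \<Rightarrow> pgraph" where
  "collected V g j v = (\<Union>{g u |u. \<exists>c<k. source V j v c = Some u})"

lemma fold_phase:
  fixes j :: nat
  assumes V: "finite V"
    and cur: "\<And>u. u \<in> V \<Longrightarrow> nodes (\<sigma> u) = V \<and> cur (\<sigma> u) = g u \<and> sendable V (g u)"
    and v: "v \<in> V"
  defines "\<sigma>' \<equiv> fold (step V) (phase j) \<sigma>"
  shows "inp (\<sigma>' v) = inp (\<sigma> v)" "nodes (\<sigma>' v) = V"
    "cur (\<sigma>' v) = (if j < l then sparsifier V (collected V g j v) else g v)"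
    "acc (\<sigma>' v) = (if j < l then acc (\<sigma> v) else acc (\<sigma> v) @ [collected V g j v])"
proof -
  define \<tau> where "\<tau> = fold (step V) (gather j (List.product [0..<k] [0..<8])) \<sigma>"
  have \<tau>: "inp (\<tau> v) = inp (\<sigma> v)" "nodes (\<tau> v) = V" "cur (\<tau> v) = g v" "acc (\<tau> v) = acc (\<sigma> v)"
    "\<And>c a. c < k \<Longrightarrow> a < 8 \<Longrightarrow> buf (\<tau> v) c a = forwarded V g j v c a"
    using fold_gather[OF V cur, where cas = "List.product [0..<k] [0..<8]" and j = j] v unfolding \<tau>_def by auto
  \<comment> \<open>Nothing spurious is decoded, as codes are nonempty and injective; nothing is
    lost, as the slots cover every transmitted graph.\<close>
  have "received (\<tau> v) = collected V g j v"
  proof (intro set_eqI iffI)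
    fix p assume "p \<in> received (\<tau> v)"
    then obtain c a q where p: "p \<in> M" "c < k" "a < 8" "forwarded V g j v c a q = Some (enc p)"
      using \<tau>(5) by (auto simp: received_def)
    then obtain u p' where u: "q \<in> V" "source V j v c = Some u" "slots V (g u) a q = Some p'" "enc p' = enc p"
      using enc_nonempty[OF p(1)] by (auto simp: forwarded_def split: if_splits option.splits)
    have s: "sendable V (g u)" using cur source_in[OF V u(2)] by blast
    then have p': "p' \<in> g u" using slots_in[OF V _ p(3) u(1,3)] by blast
    then have "p' = p" using s u(4) p(1) enc_inj by (auto simp: sendable_def inj_on_def)
    then show "p \<in> collected V g j v" using p' u(2) p(2) by (auto simp: collected_def)
  next
    fix p assume "p \<in> collected V g j v"
    then obtain c u where u: "c < k" "source V j v c = Some u" "p \<in> g u" by (auto simp: collected_def)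
    have s: "sendable V (g u)" using cur source_in[OF V u(2)] by blast
    then obtain a q where aq: "a < 8" "q \<in> V" "slots V (g u) a q = Some p"
      using slots[of V "g u"] V u(3) unfolding sendable_def by blast
    then have "buf (\<tau> v) c a q = Some (enc p)" using u \<tau>(5) by (simp add: forwarded_def)
    then show "p \<in> received (\<tau> v)" using s u aq by (auto simp: received_def sendable_def)
  qed
  moreover have "\<sigma>' = step V (Merge j) \<tau>" by (simp add: \<sigma>'_def \<tau>_def phase_def)
  ultimately show "inp (\<sigma>' v) = inp (\<sigma> v)" "nodes (\<sigma>' v) = V"
    "cur (\<sigma>' v) = (if j < l then sparsifier V (collected V g j v) else g v)"
    "acc (\<sigma>' v) = (if j < l then acc (\<sigma> v) else acc (\<sigma> v) @ [collected V g j v])"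
    using \<tau> by (simp_all add: step_def)
qed

lemma step_Start:
  assumes "v \<in> V" and ids: "\<And>u. u \<in> V \<Longrightarrow> inp (\<sigma> u) = inps u"
  shows "inp (step V (Start i) \<sigma> v) = inps v" "nodes (step V (Start i) \<sigma> v) = V"
    "cur (step V (Start i) \<sigma> v) = owned i (inps v)" "acc (step V (Start i) \<sigma> v) = acc (\<sigma> v)"
    "fin (step V (Start i) \<sigma> v) \<longleftrightarrow> fin (\<sigma> v) \<or> (\<forall>u\<in>V. \<forall>(e, w)\<in>incident_edges (inps u). w < 2 ^ i)"
proof -
  \<comment> \<open>By \<open>b_pos\<close> the one-bit announcement passes through
    \<open>clip\<close>.\<close>
  show "fin (step V (Start i) \<sigma> v) \<longleftrightarrow> fin (\<sigma> v) \<or> (\<forall>u\<in>V. \<forall>(e, w)\<in>incident_edges (inps u). w < 2 ^ i)"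
    using b_pos ids by (auto simp: step_def clip_def split: if_splits) (fastforce simp: not_le[symmetric])+
qed (use assms in \<open>auto simp: step_def dom_def split: if_splits\<close>)

lemma inp_step: "inp (step V opn \<sigma> v) = inp (\<sigma> v)"
  by (cases opn) (simp_all add: step_def)

lemma inp_config: "inp (config V inps t v) = inps v"
  by (induction t arbitrary: v) (simp_all add: inp_step)

text \<open>Every \<open>Start i\<close> executed before time \<open>I * period_length\<close> has
  \<open>i < I\<close>, and then some node still announces a heavy edge.\<close>

lemma not_fin_config:
  assumes "v \<in> V" "t \<le> I * period_length"
    and alive: "\<And>i. i < I \<Longrightarrow> \<exists>u\<in>V. \<exists>(e, w)\<in>incident_edges (inps u). 2 ^ i \<le> w"
  shows "\<not> fin (config V inps t v)"
  using assms(2)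
proof (induction t)
  case (Suc t)
  then have IH: "\<not> fin (config V inps t v)" by simp
  show ?case
  proof (cases "\<exists>i. op_at t = Start i")
    case True
    then obtain i where i: "op_at t = Start i" by blast
    then have "t = i * period_length" by (rule op_at_Start)
    then have "i < I" using Suc.prems by (metis Suc_le_lessD mult_less_cancel2)
    then show ?thesis
      using IH i alive[of i] step_Start(5)[OF \<open>v \<in> V\<close>, of "config V inps t" inps i]
      by (fastforce simp: inp_config)
  next
    case False
    then show ?thesis using IH by (cases "op_at t") (auto simp: step_def)
  qed
qed simp

end

section \<open>Merging sparsifiers along a tree\<close>

context encoding_protocol
begin

text \<open>The graphs that nodes would hold if unions could be formed directly; the simulation
  lemmas show that the messages realise them.\<close>

primrec level :: "nat set \<Rightarrow> (nat \<Rightarrow> pgraph) \<Rightarrow> nat \<Rightarrow> nat \<Rightarrow> pgraph" where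
  "level V g 0 = g"
| "level V g (Suc j) = (\<lambda>v. sparsifier V (collected V (level V g j) j v))"

lemma fold_phases:
  assumes V: "finite V"
    and start: "\<And>u. u \<in> V \<Longrightarrow> nodes (\<sigma> u) = V \<and> cur (\<sigma> u) = g u"
    and sendable: "\<And>j u. j \<le> l \<Longrightarrow> u \<in> V \<Longrightarrow> sendable V (level V g j u)"
    and "j \<le> l"
  shows "\<forall>v\<in>V. nodes (fold (step V) (concat (map phase [0..<j])) \<sigma> v) = V \<and>
    cur (fold (step V) (concat (map phase [0..<j])) \<sigma> v) = level V g j v \<and>
    acc (fold (step V) (concat (map phase [0..<j])) \<sigma> v) = acc (\<sigma> v)"
  using \<open>j \<le> l\<close>
proof (induction j)
  case (Suc j)
  define \<tau> where "\<tau> = fold (step V) (concat (map phase [0..<j])) \<sigma>"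
  have \<tau>: "nodes (\<tau> v) = V" "cur (\<tau> v) = level V g j v" "acc (\<tau> v) = acc (\<sigma> v)" if "v \<in> V" for v
    using Suc that unfolding \<tau>_def by auto
  have "fold (step V) (concat (map phase [0..<Suc j])) \<sigma> = fold (step V) (phase j) \<tau>"
    by (simp add: \<tau>_def)
  moreover have "nodes (\<tau> u) = V \<and> cur (\<tau> u) = level V g j u \<and> sendable V (level V g j u)" if "u \<in> V" for u
    using \<tau>[OF that] sendable[OF _ that, of j] Suc.prems by simp
  ultimately show ?case
    using fold_phase[OF V, where \<sigma> = \<tau> and g = "level V g j" and j = j] \<tau> Suc.prems by simp
qed (use start in simp)

lemma fold_period:
  assumes V: "finite V" and v: "v \<in> V"
    and ids: "\<And>u. u \<in> V \<Longrightarrow> inp (\<sigma> u) = inps u"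
    and sendable: "\<And>j u. j \<le> l \<Longrightarrow> u \<in> V \<Longrightarrow> sendable V (level V (\<lambda>u. owned i (inps u)) j u)"
  shows "acc (fold (step V) (period i) \<sigma> v)
       = acc (\<sigma> v) @ [collected V (level V (\<lambda>u. owned i (inps u)) l) l v]"
proof -
  let ?g = "\<lambda>u. owned i (inps u)"
  define \<sigma>1 where "\<sigma>1 = step V (Start i) \<sigma>"
  define \<tau> where "\<tau> = fold (step V) (concat (map phase [0..<l])) \<sigma>1"
  have "\<And>u. u \<in> V \<Longrightarrow> nodes (\<sigma>1 u) = V \<and> cur (\<sigma>1 u) = ?g u"
    unfolding \<sigma>1_def using step_Start(2,3)[OF _ ids] by simp
  from fold_phases[OF V this sendable order_refl]
  have \<tau>: "nodes (\<tau> u) = V \<and> cur (\<tau> u) = level V ?g l u \<and> acc (\<tau> u) = acc (\<sigma>1 u)" if "u \<in> V" for u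
    using that unfolding \<tau>_def by simp
  have "fold (step V) (period i) \<sigma> = fold (step V) (phase l) \<tau>"
    by (simp add: period_def \<tau>_def \<sigma>1_def)
  then show ?thesis
    using fold_phase(4)[OF V _ v, where \<sigma> = \<tau> and g = "level V ?g l" and j = l] \<tau> sendable[OF order_refl]
      v step_Start(4)[OF v ids, where i = i]
    by (simp add: \<sigma>1_def)
qed

end

lemma energy_UNION:
  assumes "finite C" "\<And>u. u \<in> C \<Longrightarrow> finite (g u)"
    and "\<And>u v. u \<in> C \<Longrightarrow> v \<in> C \<Longrightarrow> u \<noteq> v \<Longrightarrow> g u \<inter> g v = {}"
  shows "energy (\<Union>u\<in>C. g u) x = (\<Sum>u\<in>C. energy (g u) x)"
  unfolding energy_def using assms by (intro sum.UNION_disjoint) auto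

text \<open>\<open>D\<close> will be one weight class. The exponent range demanded of
  \<open>M\<close> leaves room for a drift of 4 per level downwards and of
  \<open>2 * l + 2 * card V\<close> upwards.\<close>

locale merge_tree = encoding_protocol k l b M enc for k l b M enc +
  fixes V :: "nat set" and D :: "nat set set"
  assumes finite_V: "finite V" and V_nonempty: "V \<noteq> {}"
    and D: "e \<in> D \<Longrightarrow> e \<subseteq> V \<and> card e = 2"
    and height: "card V \<le> k ^ l"
    and M: "e \<subseteq> V \<Longrightarrow> card e = 2 \<Longrightarrow> \<bar>i\<bar> \<le> 4 * int l + 2 * int (card V) \<Longrightarrow> (e, i) \<in> M"
begin

definition star :: "nat \<Rightarrow> pgraph" where
  "star v = {(e, 0) |e. e \<in> D \<and> Min e = v}"

abbreviation lev :: "nat \<Rightarrow> nat \<Rightarrow> pgraph" where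
  "lev \<equiv> level V star"

lemma finite_D: "finite D"
  using D finite_V by (intro finite_subset[of D "Pow V"]) auto

lemma card_V_pos: "0 < card V"
  using finite_V V_nonempty by (simp add: card_gt_0_iff)

lemma node_of_rank_eq: "m < card V \<Longrightarrow> node_of_rank V m = u \<longleftrightarrow> u \<in> V \<and> id_rank V u = m"
  using bij_betw_id_rank[OF finite_V] unfolding node_of_rank_def bij_betw_def
  by (metis f_inv_into_f inv_into_f_f inv_into_into lessThan_iff)

lemma id_rank_less: "u \<in> V \<Longrightarrow> id_rank V u < card V"
  using bij_betw_id_rank[OF finite_V] by (auto simp: bij_betw_def)

lemma id_rank_inj: "u \<in> V \<Longrightarrow> v \<in> V \<Longrightarrow> id_rank V u = id_rank V v \<Longrightarrow> u = v"
  using bij_betw_id_rank[OF finite_V] by (auto simp: bij_betw_def inj_on_def)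

lemma collected_less:
  assumes "j < l"
  shows "collected V g j v = (\<Union>u\<in>{u \<in> V. id_rank V u div k = id_rank V v}. g u)"
proof -
  have "(\<exists>c<k. source V j v c = Some u) \<longleftrightarrow> u \<in> V \<and> id_rank V u div k = id_rank V v" for u
  proof
    assume "\<exists>c<k. source V j v c = Some u"
    then obtain c where "c < k" "id_rank V v * k + c < card V" "node_of_rank V (id_rank V v * k + c) = u"
      using assms by (auto simp: source_def Let_def split: if_splits)
    then show "u \<in> V \<and> id_rank V u div k = id_rank V v" by (auto simp: node_of_rank_eq)
  next
    assume u: "u \<in> V \<and> id_rank V u div k = id_rank V v"
    then have "id_rank V u = id_rank V v * k + id_rank V u mod k" by (metis div_mult_mod_eq)
    then have "source V j v (id_rank V u mod k) = Some u"
      using assms u id_rank_less[of u] by (simp add: source_def Let_def node_of_rank_eq)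
    then show "\<exists>c<k. source V j v c = Some u" using k_pos by (intro exI[of _ "id_rank V u mod k"]) simp
  qed
  then show ?thesis unfolding collected_def by auto
qed

lemma collected_top: "collected V g l v = g (node_of_rank V 0)"
proof -
  have "(\<exists>c<k. source V l v c = Some u) \<longleftrightarrow> u = node_of_rank V 0" for u
    using k_pos card_V_pos by (auto simp: source_def Let_def)
  then show ?thesis unfolding collected_def by auto
qed

definition level_energy :: "nat \<Rightarrow> (nat \<Rightarrow> real) \<Rightarrow> real" where
  "level_energy j x = (\<Sum>v\<in>V. energy (lev j v) x)"

text \<open>The last clause confines the edge \<open>e\<close> at level \<open>j\<close> to one holder; hence the graphs held at a
  level are edge-disjoint, and at level \<open>l\<close> only the node of rank 0 holds edges.\<close>

definition proper :: "nat \<Rightarrow> bool" where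
  "proper j \<longleftrightarrow> (\<forall>v\<in>V. pgraph V (lev j v) \<and> card (lev j v) \<le> 8 * card V \<and>
     (\<forall>(e, i)\<in>lev j v. e \<in> D \<and> - 4 * int j \<le> i \<and> id_rank V (Min e) div k ^ j = id_rank V v))"

lemma star_proper: "proper 0"
  unfolding proper_def
proof (intro ballI conjI)
  fix v assume "v \<in> V"
  have fin: "finite (star v)"
    using finite_D by (intro finite_subset[of "star v" "D \<times> {0}"]) (auto simp: star_def)
  have inj: "inj_on fst (star v)" by (auto simp: star_def inj_on_def)
  then show "pgraph V (lev 0 v)" using D fin by (auto simp: pgraph_def star_def)
  \<comment> \<open>Edges of a star share their minimum, so the maximum determines the edge, and a
    star has at most \<open>card V\<close> of them.\<close>
  have "inj_on (\<lambda>p. Max (fst p)) (star v)"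
  proof (rule inj_onI)
    fix p p' assume p: "p \<in> star v" "p' \<in> star v" "Max (fst p) = Max (fst p')"
    then have "Min (fst p) = Min (fst p')" "fst p \<in> D" "fst p' \<in> D" by (auto simp: star_def)
    then have "fst p = fst p'" using p(3) D card_2_Min_Max(1) by metis
    then show "p = p'" using inj p by (auto simp: inj_on_def)
  qed
  moreover have "(\<lambda>p. Max (fst p)) ` star v \<subseteq> V"
  proof
    fix m assume "m \<in> (\<lambda>p. Max (fst p)) ` star v"
    then obtain e where "e \<in> D" "m = Max e" by (auto simp: star_def)
    then show "m \<in> V" using D card_2_Min_Max(1)[of e] by blast
  qed
  ultimately have "card (star v) \<le> card V" using finite_V by (rule card_inj_on_le)
  then show "card (lev 0 v) \<le> 8 * card V" by simp
  show "case p of (e, i) \<Rightarrow> e \<in> D \<and> - 4 * int 0 \<le> i \<and> id_rank V (Min e) div k ^ 0 = id_rank V v"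
    if "p \<in> lev 0 v" for p
    using that by (auto simp: star_def)
qed

lemma level_energy_0: "level_energy 0 x = (\<Sum>e\<in>D. (bdiff e x)\<^sup>2)"
proof -
  have "energy (star v) x = (\<Sum>e\<in>{e \<in> D. Min e = v}. (bdiff e x)\<^sup>2)" for v
  proof -
    have "star v = (\<lambda>e. (e, 0)) ` {e \<in> D. Min e = v}" by (auto simp: star_def)
    then show ?thesis by (simp add: energy_def sum.reindex inj_on_def)
  qed
  moreover have "Min ` D \<subseteq> V"
  proof
    fix m assume "m \<in> Min ` D"
    then obtain e where "e \<in> D" "m = Min e" by blast
    then show "m \<in> V" using D card_2_Min_Max(1)[of e] by blast
  qed
  ultimately show ?thesis
    unfolding level_energy_def using sum.group[OF finite_D finite_V] by simp
qed

lemma disjoint_levels: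
  assumes "proper j" "u \<in> V" "v \<in> V" "(e, i) \<in> lev j u" "(e, i') \<in> lev j v"
  shows "u = v"
proof -
  have "id_rank V (Min e) div k ^ j = id_rank V u" "id_rank V (Min e) div k ^ j = id_rank V v"
    using assms unfolding proper_def by blast+
  then show ?thesis using id_rank_inj assms by metis
qed

text \<open>Edge-disjointness makes the energy of a union additive, and every node has exactly one
  parent; summing the guarantees of the local sparsifiers therefore bounds the total energy.\<close>

lemma level_step:
  assumes "j < l" and proper: "proper j"
  shows "proper (Suc j) \<and> level_energy (Suc j) x \<le> 3 * level_energy j x \<and> level_energy j x \<le> 12 * level_energy (Suc j) x"
proof -
  define C where "C v = {u \<in> V. id_rank V u div k = id_rank V v}" for v
  define X where "X v = (\<Union>u\<in>C v. lev j u)" for v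
  have CV: "C v \<subseteq> V" "finite (C v)" for v using finite_V by (auto simp: C_def)
  have lev: "pgraph V (lev j u)" "\<And>e i. (e, i) \<in> lev j u \<Longrightarrow> e \<in> D"
    "\<And>e i. (e, i) \<in> lev j u \<Longrightarrow> - 4 * int j \<le> i"
    "\<And>e i. (e, i) \<in> lev j u \<Longrightarrow> id_rank V (Min e) div k ^ j = id_rank V u" if "u \<in> V" for u
    using proper that unfolding proper_def by blast+
  have suc: "lev (Suc j) v = sparsifier V (X v)" for v
    by (simp add: collected_less[OF \<open>j < l\<close>] X_def C_def)
  have X: "pgraph V (X v)" for v
    unfolding pgraph_def
  proof (intro conjI)
    show "finite (X v)"
      using CV lev(1) unfolding X_def pgraph_def by blast
    show "inj_on fst (X v)"
    proof (rule inj_onI)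
      fix p p' assume p: "p \<in> X v" "p' \<in> X v" "fst p = fst p'"
      then obtain u u' where u: "u \<in> V" "p \<in> lev j u" and u': "u' \<in> V" "p' \<in> lev j u'"
        using CV unfolding X_def by blast
      moreover have "p = (fst p, snd p)" "p' = (fst p, snd p')" using p(3) by (simp_all add: prod_eq_iff)
      ultimately have "u = u'" using disjoint_levels[OF proper u(1) u'(1)] by metis
      then show "p = p'" using lev(1)[OF u(1)] u u' p(3) by (auto simp: pgraph_def inj_on_def)
    qed
    show "\<forall>e\<in>fst ` X v. e \<subseteq> V \<and> card e = 2"
      using CV lev(1) unfolding X_def pgraph_def by blast
  qed
  have sp: "sparsifies V (X v) (lev (Suc j) v)" for v
    unfolding suc using sparsifier[OF X finite_V V_nonempty] .
  have energy_X: "energy (X v) x = (\<Sum>u\<in>C v. energy (lev j u) x)" for v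
    unfolding X_def
  proof (rule energy_UNION)
    show "finite (lev j u)" if "u \<in> C v" for u using lev(1) CV that unfolding pgraph_def by blast
    fix u u' assume "u \<in> C v" "u' \<in> C v" "u \<noteq> u'"
    then show "lev j u \<inter> lev j u' = {}" using disjoint_levels[OF proper] CV by fastforce
  qed (rule CV)
  have "(\<Sum>v\<in>V. energy (X v) x) = level_energy j x"
  proof -
    \<comment> \<open>\<open>f u\<close> is the parent of \<open>u\<close>; its fibres are the sets
      of children.\<close>
    define f where "f u = node_of_rank V (id_rank V u div k)" for u
    have less: "id_rank V u div k < card V" if "u \<in> V" for u
      using id_rank_less[OF that] by (meson div_le_dividend le_less_trans)
    have f: "f u = v \<longleftrightarrow> v \<in> V \<and> id_rank V v = id_rank V u div k" if "u \<in> V" for u v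
      unfolding f_def using that by (intro node_of_rank_eq less)
    have "C v = {u \<in> V. f u = v}" if "v \<in> V" for v
      unfolding C_def using that by (intro Collect_cong conj_cong refl) (metis f)
    moreover have "f ` V \<subseteq> V"
      using f by blast
    ultimately show ?thesis
      unfolding level_energy_def energy_X using sum.group[OF finite_V finite_V, of f "\<lambda>u. energy (lev j u) x"]
      by simp
  qed
  moreover have "level_energy (Suc j) x \<le> (\<Sum>v\<in>V. 3 * energy (X v) x)"
    unfolding level_energy_def using sp by (intro sum_mono) (auto simp: sparsifies_def)
  moreover have "(\<Sum>v\<in>V. energy (X v) x) \<le> 12 * level_energy (Suc j) x"
    unfolding level_energy_def sum_distrib_left using sp by (intro sum_mono) (auto simp: sparsifies_def)
  ultimately have "level_energy (Suc j) x \<le> 3 * level_energy j x" "level_energy j x \<le> 12 * level_energy (Suc j) x"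
    by (simp_all add: sum_distrib_left[symmetric])
  moreover have "proper (Suc j)"
    unfolding proper_def
  proof (intro ballI conjI)
    fix v assume v: "v \<in> V"
    show "pgraph V (lev (Suc j) v)" "card (lev (Suc j) v) \<le> 8 * card V"
      using sp[of v] unfolding sparsifies_def by blast+
    fix p assume p: "p \<in> lev (Suc j) v"
    obtain e i' where ei': "p = (e, i')" by force
    then have "e \<in> fst ` X v" using sp[of v] p unfolding sparsifies_def by force
    then obtain i where i: "(e, i) \<in> X v" by force
    then obtain u where u: "(e, i) \<in> lev j u" "u \<in> V" "id_rank V u div k = id_rank V v"
      unfolding X_def C_def by auto
    have "i - 4 \<le> i'" using sp[of v] i p ei' unfolding sparsifies_def by blast
    moreover have "id_rank V (Min e) div k ^ Suc j = id_rank V v"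
      using lev(4)[OF u(2,1)] u(3) unfolding power_Suc2 div_mult2_eq by simp
    ultimately show "case p of (e, i) \<Rightarrow> e \<in> D \<and> - 4 * int (Suc j) \<le> i \<and>
        id_rank V (Min e) div k ^ Suc j = id_rank V v"
      using lev(2,3)[OF u(2,1)] ei' by simp
  qed
  ultimately show ?thesis by blast
qed

lemma level_proper:
  assumes "j \<le> l"
  shows "proper j \<and> level_energy j x \<le> 3 ^ j * level_energy 0 x \<and> level_energy 0 x \<le> 12 ^ j * level_energy j x"
  using assms
proof (induction j)
  case (Suc j)
  then have IH: "proper j" "level_energy j x \<le> 3 ^ j * level_energy 0 x" "level_energy 0 x \<le> 12 ^ j * level_energy j x" by auto
  have S: "proper (Suc j)" "level_energy (Suc j) x \<le> 3 * level_energy j x" "level_energy j x \<le> 12 * level_energy (Suc j) x"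
    using level_step[OF _ IH(1), of x] Suc.prems by auto
  have "level_energy 0 x \<le> 12 ^ j * (12 * level_energy (Suc j) x)"
    using S(3) by (intro order_trans[OF IH(3)] mult_left_mono) auto
  moreover have "level_energy (Suc j) x \<le> 3 * (3 ^ j * level_energy 0 x)"
    using IH(2) by (intro order_trans[OF S(2)] mult_left_mono) auto
  ultimately show ?case using S(1) by (simp add: mult_ac)
qed (simp add: star_proper)

text \<open>A crude count of edges; only its logarithm enters the code length.\<close>

lemma level_energy_0_le: 
  assumes "\<And>v. \<bar>x v\<bar> \<le> 1" "\<And>v. 0 \<le> x v"
  shows "level_energy 0 x \<le> 2 ^ (2 * card V)"
proof -
  have "(bdiff e x)\<^sup>2 \<le> 1" for e
    using assms(1)[of "Max e"] assms(1)[of "Min e"] assms(2)[of "Max e"] assms(2)[of "Min e"]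
    by (subst abs_square_le_1) (simp add: bdiff_def abs_if)
  then have "level_energy 0 x \<le> (\<Sum>e\<in>D. 1)" unfolding level_energy_0 by (intro sum_mono) auto
  also have "\<dots> = card D" by simp
  also have "card D \<le> card (Pow V)" using D finite_V by (intro card_mono) auto
  also have "\<dots> = 2 ^ card V" using finite_V by (rule card_Pow)
  also have "\<dots> \<le> 2 ^ (2 * card V)" by (intro power_increasing) auto
  finally show ?thesis by simp
qed

text \<open>For the upper bound on the exponent the form is tested at the indicator of
  \<open>Max e\<close>: there the edge contributes its full weight, while the total energy is at
  most \<open>3 ^ j\<close> times the initial one. The lower bound is part of
  \<open>proper\<close>.\<close>

lemma sendable_level:
  assumes "j \<le> l" "v \<in> V"
  shows "sendable V (lev j v)"
proof -
  have P: "proper j" using level_proper[OF assms(1)] by blast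
  have "(e, i) \<in> M" if ei: "(e, i) \<in> lev j v" for e i
  proof (rule M)
    have e: "e \<in> D" "- 4 * int j \<le> i" using P ei assms(2) unfolding proper_def by blast+
    then show "e \<subseteq> V" "card e = 2" using D by auto
    define x :: "nat \<Rightarrow> real" where "x = (\<lambda>u. of_bool (u = Max e))"
    have fin: "finite (lev j u)" if "u \<in> V" for u using P that unfolding proper_def pgraph_def by blast
    have "Min e < Max e" using card_2_Min_Max(2) e(1) D by blast
    then have "2 powr i = 2 powr i * (bdiff e x)\<^sup>2" by (simp add: x_def bdiff_def)
    also have "\<dots> = (\<lambda>(e, i). 2 powr real_of_int i * (bdiff e x)\<^sup>2) (e, i)" by simp
    also have "\<dots> \<le> energy (lev j v) x"
      unfolding energy_def using ei fin[OF assms(2)] by (intro member_le_sum) auto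
    also have "\<dots> \<le> level_energy j x"
      unfolding level_energy_def using assms(2) finite_V by (intro member_le_sum) (auto intro: energy_nonneg)
    also have "\<dots> \<le> 3 ^ j * level_energy 0 x" using level_proper[OF assms(1)] by blast
    also have "\<dots> \<le> 4 ^ l * 2 ^ (2 * card V)"
    proof (rule mult_mono)
      have "(3::real) ^ j \<le> 4 ^ j" by (intro power_mono) auto
      also have "\<dots> \<le> 4 ^ l" using assms(1) by (intro power_increasing) auto
      finally show "(3::real) ^ j \<le> 4 ^ l" .
      show "level_energy 0 x \<le> 2 ^ (2 * card V)" by (rule level_energy_0_le) (auto simp: x_def)
      show "0 \<le> level_energy 0 x" unfolding level_energy_def by (intro sum_nonneg energy_nonneg)
    qed simp
    also have "(4::real) ^ l * 2 ^ (2 * card V) = 2 ^ (2 * l + 2 * card V)"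
      by (simp add: power_add power_mult)
    also have "\<dots> = 2 powr real_of_int (int (2 * l + 2 * card V))"
      by (simp add: powr_realpow[symmetric])
    finally have "real_of_int i \<le> real_of_int (int (2 * l + 2 * card V))"
      by (subst (asm) powr_le_cancel_iff) auto
    then have "i \<le> int (2 * l + 2 * card V)" by (simp only: of_int_le_iff)
    then show "\<bar>i\<bar> \<le> 4 * int l + 2 * int (card V)" using e(2) assms(1) by auto
  qed
  then show ?thesis using P assms(2) unfolding proper_def pgraph_def sendable_def by auto
qed

definition root_graph :: pgraph where
  "root_graph = lev l (node_of_rank V 0)"

lemma collected_root_graph_level: "collected V (lev l) l v = root_graph"
  by (simp add: collected_top root_graph_def)

lemma root_node: "node_of_rank V 0 \<in> V"
  using node_of_rank_eq[OF card_V_pos] by blast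

lemma root_graph_edges: "fst ` root_graph \<subseteq> D" and card_root_graph: "card root_graph \<le> 8 * card V" and finite_root_graph: "finite root_graph"
proof -
  have P: "proper l" using level_proper[OF order_refl] by blast
  show "fst ` root_graph \<subseteq> D" "card root_graph \<le> 8 * card V" "finite root_graph"
    using P[unfolded proper_def, rule_format, OF root_node] unfolding root_graph_def pgraph_def by auto
qed

lemma energy_root_graph: "energy root_graph x = level_energy l x"
proof -
  have "lev l v = {}" if v: "v \<in> V" "v \<noteq> node_of_rank V 0" for v
  proof -
    have P: "proper l" using level_proper[OF order_refl] by blast
    have False if ei: "(e, i) \<in> lev l v" for e i
    proof -
      have e: "e \<in> D" "id_rank V (Min e) div k ^ l = id_rank V v"
        using P[unfolded proper_def, rule_format, OF v(1)] ei by auto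
      have "Min e \<in> V" using e(1) D card_2_Min_Max(1)[of e] by blast
      then have "id_rank V (Min e) div k ^ l = 0" using id_rank_less[of "Min e"] height by simp
      then show False using e(2) v node_of_rank_eq[OF card_V_pos, of v] by auto
    qed
    then show ?thesis by auto
  qed
  then have "level_energy l x = (\<Sum>v\<in>V. if v = node_of_rank V 0 then energy root_graph x else 0)"
    unfolding level_energy_def by (intro sum.cong) (auto simp: root_graph_def energy_def)
  then show ?thesis using finite_V root_node by simp
qed

lemma energy_root_graph_bounds:
  "energy root_graph x \<le> 3 ^ l * (\<Sum>e\<in>D. (bdiff e x)\<^sup>2)"
  "(\<Sum>e\<in>D. (bdiff e x)\<^sup>2) \<le> 12 ^ l * energy root_graph x"
  using level_proper[of l x] by (simp_all add: energy_root_graph level_energy_0)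

end

section \<open>Parameters and correctness\<close>

text \<open>Exchange of summation: \<open>out_weight\<close> collects the occurrences of an edge in
  all graphs, each scaled back by the \<open>2 ^ i\<close> of its class.\<close>

lemma out_form:
  assumes "\<And>g. g \<in> set gs \<Longrightarrow> finite g"
  shows "(\<Sum>e\<in>protocol.out_edges gs. protocol.out_weight gs e * (bdiff e x)\<^sup>2)
       = (\<Sum>i<length gs. 2 ^ i * energy (gs ! i) x)"
proof -
  let ?F = "protocol.out_edges gs"
  define t where "t i p = 2 ^ i * (2 powr real_of_int (snd p) * (bdiff (fst p) x)\<^sup>2)"
    for i :: nat and p :: "nat set \<times> int"
  have fin: "finite (gs ! i)" if "i < length gs" for i using assms that by simp
  then have F: "finite ?F" by (auto simp: protocol.out_edges_def)
  have "(\<Sum>e\<in>?F. protocol.out_weight gs e * (bdiff e x)\<^sup>2)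
      = (\<Sum>e\<in>?F. \<Sum>i<length gs. \<Sum>p\<in>{p \<in> gs ! i. fst p = e}. t i p)"
    unfolding protocol.out_weight_def sum_distrib_right
    by (intro sum.cong refl) (auto simp: t_def powr_add powr_realpow)
  also have "\<dots> = (\<Sum>i<length gs. \<Sum>e\<in>?F. \<Sum>p\<in>{p \<in> gs ! i. fst p = e}. t i p)"
    by (rule sum.swap)
  also have "\<dots> = (\<Sum>i<length gs. \<Sum>p\<in>gs ! i. t i p)"
    using fin F by (intro sum.cong refl sum.group) (auto simp: protocol.out_edges_def)
  also have "\<dots> = (\<Sum>i<length gs. 2 ^ i * energy (gs ! i) x)"
    by (simp add: energy_def t_def case_prod_unfold sum_distrib_left)
  finally show ?thesis .
qed

lemma card_out_edges:
  assumes "\<And>g. g \<in> set gs \<Longrightarrow> finite g \<and> card g \<le> m"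
  shows "card (protocol.out_edges gs) \<le> m * length gs"
proof -
  have "card (protocol.out_edges gs) \<le> (\<Sum>i<length gs. card (fst ` (gs ! i)))"
    unfolding protocol.out_edges_def by (rule card_UN_le) simp
  also have "\<dots> \<le> (\<Sum>i<length gs. m)"
    using assms by (intro sum_mono order_trans[OF card_image_le]) auto
  finally show ?thesis by (simp add: mult.commute)
qed

section \<open>Splitting into weight classes and a complete run\<close>

definition weight_class :: "nat set set \<Rightarrow> (nat set \<Rightarrow> nat) \<Rightarrow> nat \<Rightarrow> nat set set" where
  "weight_class E w i = {e \<in> E. 2 ^ i \<le> w e \<and> w e < 2 ^ Suc i}"

lemma weight_class_disjoint:
  assumes "e \<in> weight_class E w i" "e \<in> weight_class E w j" shows "i = j"
proof -
  have e: "2 ^ i \<le> w e" "w e < 2 ^ Suc i" "2 ^ j \<le> w e" "w e < 2 ^ Suc j"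
    using assms unfolding weight_class_def by blast+
  have "i < Suc j" using le_less_trans[OF e(1,4)] by (rule power_less_imp_less_exp[rotated]) simp
  moreover have "j < Suc i" using le_less_trans[OF e(3,2)] by (rule power_less_imp_less_exp[rotated]) simp
  ultimately show ?thesis by simp
qed

text \<open>Within class \<open>i\<close> a weight exceeds \<open>2 ^ i\<close> by a factor below 2;
  this is the whole cost of treating the class as unweighted.\<close>

lemma sum_weight_classes:
  fixes f :: "nat set \<Rightarrow> real"
  assumes "finite E" "\<And>e. e \<in> E \<Longrightarrow> 1 \<le> w e \<and> w e < 2 ^ m" "\<And>e. 0 \<le> f e"
  shows "(\<Sum>i<m. 2 ^ i * (\<Sum>e\<in>weight_class E w i. f e)) \<le> (\<Sum>e\<in>E. w e * f e)"
    "(\<Sum>e\<in>E. w e * f e) \<le> 2 * (\<Sum>i<m. 2 ^ i * (\<Sum>e\<in>weight_class E w i. f e))"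
proof -
  have E: "E = (\<Union>i<m. weight_class E w i)"
  proof (intro equalityI subsetI)
    fix e assume e: "e \<in> E"
    then obtain i where i: "2 ^ i \<le> w e" "w e < 2 ^ (i + 1)"
      using ex_power_ivl1[of 2 "w e"] assms(2) by auto
    have "(2::nat) ^ i < 2 ^ m" using i(1) assms(2)[OF e] by linarith
    then have "i < m" by (rule power_less_imp_less_exp[rotated]) simp
    then show "e \<in> (\<Union>i<m. weight_class E w i)" using i e by (auto simp: weight_class_def)
  qed (auto simp: weight_class_def)
  have "(\<Sum>e\<in>E. w e * f e) = (\<Sum>e\<in>(\<Union>i<m. weight_class E w i). w e * f e)"
    using E by simp
  also have "\<dots> = (\<Sum>i<m. \<Sum>e\<in>weight_class E w i. w e * f e)"
    using assms(1) weight_class_disjoint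
    by (intro sum.UNION_disjoint) (auto simp: weight_class_def intro: finite_subset[OF _ assms(1)])
  finally have sum: "(\<Sum>e\<in>E. w e * f e) = (\<Sum>i<m. \<Sum>e\<in>weight_class E w i. w e * f e)" .
  show "(\<Sum>i<m. 2 ^ i * (\<Sum>e\<in>weight_class E w i. f e)) \<le> (\<Sum>e\<in>E. w e * f e)"
    unfolding sum sum_distrib_left
  proof (intro sum_mono mult_right_mono assms)
    fix i e assume "e \<in> weight_class E w i"
    then have "2 ^ i \<le> w e" by (simp add: weight_class_def)
    then have "real (2 ^ i) \<le> real (w e)" by (simp only: of_nat_le_iff)
    then show "2 ^ i \<le> real (w e)" by simp
  qed
  show "(\<Sum>e\<in>E. w e * f e) \<le> 2 * (\<Sum>i<m. 2 ^ i * (\<Sum>e\<in>weight_class E w i. f e))"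
    unfolding sum sum_distrib_left mult.assoc[symmetric]
  proof (intro sum_mono mult_right_mono assms)
    fix i e assume "e \<in> weight_class E w i"
    then have "w e \<le> 2 * 2 ^ i" by (simp add: weight_class_def)
    then have "real (w e) \<le> real (2 * 2 ^ i)" by (simp only: of_nat_le_iff)
    then show "real (w e) \<le> 2 * 2 ^ i" by simp
  qed
qed

context encoding_protocol
begin

lemma run_correct:
  fixes V :: "nat set" and E w n r
  defines "inps \<equiv> initial_knowledge n r E w"
  assumes snd: "\<And>v h. v \<in> V \<Longrightarrow> send A (inps v) h = send_message (inps v) h"
    and dec: "\<And>v h. v \<in> V \<Longrightarrow> decide A (inps v) h = decision (inps v) h"
    and G: "simple_graph V E" and V: "V \<noteq> {}" and height: "card V \<le> k ^ l"
    and M: "\<And>e i. e \<subseteq> V \<Longrightarrow> card e = 2 \<Longrightarrow> \<bar>i\<bar> \<le> 4 * int l + 2 * int (card V) \<Longrightarrow> (e, i) \<in> M"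
    and w1: "\<And>e. e \<in> E \<Longrightarrow> 1 \<le> w e" and wI: "\<And>e. e \<in> E \<Longrightarrow> w e < 2 ^ I"
    and alive: "\<And>i. i < I \<Longrightarrow> \<exists>e\<in>E. 2 ^ i \<le> w e"
  obtains F wH where "F \<subseteq> E" "card F \<le> 8 * card V * I"
    "\<And>x. quadratic_form V (laplacian F wH) x \<le> 3 ^ l * quadratic_form V (laplacian E w) x"
    "\<And>x. quadratic_form V (laplacian E w) x \<le> 2 * 12 ^ l * quadratic_form V (laplacian F wH) x"
    "\<And>v. v \<in> V \<Longrightarrow> node_outputs A V inps (I * period_length + 1) v (F, wH)"
proof -
  have finV: "finite V" and E: "\<And>e. e \<in> E \<Longrightarrow> e \<subseteq> V \<and> card e = 2"
    using G by (auto simp: simple_graph_def)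
  have finE: "finite E" using E finV by (intro finite_subset[of E "Pow V"]) auto
  have "merge_tree_axioms k l M V (weight_class E w i)" for i
    unfolding merge_tree_axioms_def using finV V E height M unfolding weight_class_def by blast
  then interpret T: merge_tree k l b M enc V "weight_class E w i" for i
    using encoding_protocol_axioms by (intro merge_tree.intro)
  have own: "own_id (inps v) = v" for v by (simp add: inps_def initial_knowledge_def)
  have edges: "incident_edges (inps v) = {(e, w e) |e. e \<in> E \<and> v \<in> e}" for v
    by (simp add: inps_def initial_knowledge_def)
  have Min_in: "Min e \<in> e" if "e \<in> E" for e
    using card_2_Min_Max(1) E[OF that] by blast
  have star: "(\<lambda>u. owned i (inps u)) = T.star i" for i
  proof (intro ext set_eqI)
    fix u p
    show "p \<in> owned i (inps u) \<longleftrightarrow> p \<in> T.star i u"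
      unfolding owned_def T.star_def edges own mem_Collect_eq prod.inject
      unfolding weight_class_def using Min_in by blast
  qed
  have acc: "acc (config V inps (i * period_length) v) = map T.root_graph [0..<i]" if v: "v \<in> V" for i v
  proof (induction i)
    case (Suc i)
    have "acc (config V inps (Suc i * period_length) v)
        = acc (config V inps (i * period_length) v) @
          [collected V (level V (\<lambda>u. owned i (inps u)) l) l v]"
      unfolding config_period using T.sendable_level[of _ _ i]
      by (intro fold_period[OF finV v]) (simp_all add: inp_config star)
    then show ?case using Suc T.collected_root_graph_level[of i v] by (simp add: star)
  qed simp
  define gs where "gs = map T.root_graph [0..<I]"
  have fin_gs: "finite g \<and> card g \<le> 8 * card V" if "g \<in> set gs" for g
    using that T.finite_root_graph T.card_root_graph by (auto simp: gs_def)
  have sub: "out_edges gs \<subseteq> E"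
    using T.root_graph_edges by (force simp: out_edges_def gs_def weight_class_def)
  then have H: "simple_graph V (out_edges gs)" using G by (auto simp: simple_graph_def)
  have form_H: "quadratic_form V (laplacian (out_edges gs) (out_weight gs)) x
      = (\<Sum>i<I. 2 ^ i * energy (T.root_graph i) x)" for x
    unfolding quadratic_form_laplacian[OF H]
    using out_form[of gs x] fin_gs by (simp add: gs_def)
  define cl where "cl x = (\<Sum>i<I. 2 ^ i * (\<Sum>e\<in>weight_class E w i. (bdiff e x)\<^sup>2))" for x
  have cl: "cl x \<le> quadratic_form V (laplacian E w) x" "quadratic_form V (laplacian E w) x \<le> 2 * cl x" for x
    unfolding quadratic_form_laplacian[OF G] cl_def
    using sum_weight_classes[of E w I "\<lambda>e. (bdiff e x)\<^sup>2"] finE w1 wI by auto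
  have upper: "quadratic_form V (laplacian (out_edges gs) (out_weight gs)) x \<le> 3 ^ l * cl x" for x
    unfolding form_H cl_def sum_distrib_left
    using T.energy_root_graph_bounds(1) by (intro sum_mono) (simp add: mult.left_commute sum_distrib_left[symmetric])
  have lower: "cl x \<le> 12 ^ l * quadratic_form V (laplacian (out_edges gs) (out_weight gs)) x" for x
    unfolding form_H cl_def sum_distrib_left
    using T.energy_root_graph_bounds(2) by (intro sum_mono) (simp add: mult.left_commute sum_distrib_left[symmetric])
  show thesis
  proof (rule that[of "out_edges gs" "out_weight gs"])
    show "card (out_edges gs) \<le> 8 * card V * I"
      using card_out_edges[of gs "8 * card V"] fin_gs by (simp add: gs_def)
    show "quadratic_form V (laplacian (out_edges gs) (out_weight gs)) x
        \<le> 3 ^ l * quadratic_form V (laplacian E w) x" for x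
      by (rule order_trans[OF upper mult_left_mono[OF cl(1)]]) simp
    show "quadratic_form V (laplacian E w) x
        \<le> 2 * 12 ^ l * quadratic_form V (laplacian (out_edges gs) (out_weight gs)) x" for x
      using lower[of x] cl(2)[of x] by simp
    fix v assume v: "v \<in> V"
    have state: "state (inps v) (history A V inps t v) = config V inps t v" for t
      using snd own v by (rule state_history)
    have "\<exists>u\<in>V. \<exists>(e, w)\<in>incident_edges (inps u). 2 ^ i \<le> w" if i: "i < I" for i
    proof -
      obtain e where "e \<in> E" "2 ^ i \<le> w e" using alive[OF i] by blast
      then show ?thesis
        using Min_in[of e] E[of e] by (intro bexI[of _ "Min e"] bexI[of _ "(e, w e)"]) (auto simp: edges)
    qed
    then have "\<not> fin (config V inps s v)" if "s \<le> I * period_length" for s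
      using not_fin_config[OF v that] by blast
    moreover have decide: "decide A (inps v) (history A V inps s v) =
        (if fin (config V inps s v)
         then Some (out_edges (acc (config V inps s v)), out_weight (acc (config V inps s v))) else None)" for s
      by (simp only: dec[OF v] decision_def state)
    ultimately have early: "decide A (inps v) (history A V inps s v) = None" if "s < I * period_length + 1" for s
      using that by simp
    \<comment> \<open>The additional round is the \<open>Start\<close> of period \<open>I\<close>,
      in which nobody announces a heavier edge: \<open>fin\<close> becomes true and
      \<open>acc\<close> holds the \<open>I\<close> finished classes.\<close>
    have conf: "config V inps (I * period_length + 1) = step V (Start I) (config V inps (I * period_length))"
      by (simp add: op_at_period_start)
    have "fin (config V inps (I * period_length + 1) v)"
      "acc (config V inps (I * period_length + 1) v) = gs"
      unfolding conf using step_Start(4,5)[OF v inp_config, of I] wI acc[OF v]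
      by (auto simp: edges gs_def)
    then show "node_outputs A V inps (I * period_length + 1) v (out_edges gs, out_weight gs)"
      unfolding node_outputs_def using early decide[of "I * period_length + 1"] by metis
  qed (rule sub)
qed

end


section \<open>Choice of parameters and numerical estimates\<close>

lemma encoding_exists:
  fixes M :: "'a set"
  assumes "finite M" "card M \<le> 2 ^ b"
  shows "\<exists>enc :: 'a \<Rightarrow> message. inj_on enc M \<and> (\<forall>p\<in>M. length (enc p) = b)"
proof -
  have "finite {m :: message. set m \<subseteq> UNIV \<and> length m = b}" by (rule finite_lists_length_eq) simp
  moreover have "card {m :: message. set m \<subseteq> UNIV \<and> length m = b} = 2 ^ b"
    by (subst card_lists_length_eq) simp_all
  ultimately obtain enc :: "'a \<Rightarrow> message"
    where "enc ` M \<subseteq> {m. set m \<subseteq> UNIV \<and> length m = b}" "inj_on enc M"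
    using card_le_inj[of M "{m :: message. set m \<subseteq> UNIV \<and> length m = b}"] assms by auto
  then show ?thesis by blast
qed

definition fanout :: "nat \<Rightarrow> real \<Rightarrow> nat" where
  "fanout n r = nat \<lceil>n powr (1 / r\<^sup>2)\<rceil>"

definition depth :: "real \<Rightarrow> nat" where
  "depth r = nat \<lceil>r\<^sup>2\<rceil>"

text \<open>Two identifiers below \<open>n ^ c\<close> take \<open>2 * c * log 2 n\<close> bits, the
  exponent at most \<open>5 * log 2 n\<close>; one more \<open>log 2 n\<close> absorbs the rounding
  down.\<close>

definition message_length :: "nat \<Rightarrow> nat \<Rightarrow> nat" where
  "message_length c n = nat \<lfloor>(2 * real c + 6) * log 2 n\<rfloor>"

text \<open>Built from the public values alone, with all potential identifiers in place of
  \<open>V\<close>, because the encoding is fixed before the node set is known.\<close>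

definition edge_codes :: "nat \<Rightarrow> nat \<Rightarrow> real \<Rightarrow> pgraph" where
  "edge_codes c n r = {e. e \<subseteq> {..<n ^ c} \<and> card e = 2} \<times>
     {- (4 * int (depth r) + 2 * int n)..4 * int (depth r) + 2 * int n}"

text \<open>The choice depends on public values only, so sender and receiver use the same
  code.\<close>

definition encode :: "nat \<Rightarrow> nat \<Rightarrow> real \<Rightarrow> nat set \<times> int \<Rightarrow> message" where
  "encode c n r = (SOME enc. inj_on enc (edge_codes c n r) \<and>
     (\<forall>p\<in>edge_codes c n r. length (enc p) = message_length c n))"

definition algorithm :: "nat \<Rightarrow> (local_input, nat set set \<times> (nat set \<Rightarrow> real)) cc_algorithm" where
  "algorithm c =
    \<lparr>send = (\<lambda>x. let n = num_nodes x; r = parameter x in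
       protocol.send_message (fanout n r) (depth r) (message_length c n) (edge_codes c n r) (encode c n r) x),
     decide = (\<lambda>x. let n = num_nodes x; r = parameter x in
       protocol.decision (fanout n r) (depth r) (message_length c n) (edge_codes c n r) (encode c n r) x)\<rparr>"

locale parameters =
  fixes c n :: nat and r L :: real
  defines "L \<equiv> log 2 n"
  assumes n: "3 \<le> n" and r1: "1 \<le> r" and r2: "r \<le> sqrt (log 2 n / log 2 (log 2 n))"
begin

text \<open>From \<open>2 ^ 3 \<le> 3 ^ 2\<close>. Being bounded away from 1, \<open>L\<close> has
  powers that absorb constants.\<close>

lemma L_ge: "3 / 2 \<le> L"
proof -
  have "3 = log 2 ((2::real) ^ 3)" by (subst log_nat_power) auto
  also have "\<dots> \<le> log 2 ((real n) ^ 2)"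
    using n power_mono[of 3 "real n" 2] by (subst log_le_cancel_iff) auto
  also have "\<dots> = 2 * L" using n by (subst log_nat_power) (auto simp: L_def)
  finally show ?thesis by simp
qed

lemma L_le: "L \<le> n"
  using log2_of_power_le[of n n] n unfolding L_def by (simp add: less_imp_le)

text \<open>Since \<open>L\<^sup>2 \<ge> 9/4\<close>, the inner logarithm is at least 1/2, and the
  assumed bound on \<open>r\<close> gives
  \<open>r\<^sup>2 \<le> L / log 2 L \<le> 2 * L\<close>.\<close>

lemma r_square: "1 \<le> r\<^sup>2" "r\<^sup>2 \<le> 2 * L"
proof -
  show "1 \<le> r\<^sup>2" using r1 by (simp add: power2_eq_square mult_ge1_I)
  have "1 = log 2 (2::real)" by simp
  also have "\<dots> \<le> log 2 (L ^ 2)"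
    using L_ge power_mono[of "3/2" L 2] by (subst log_le_cancel_iff) (auto simp: power2_eq_square)
  also have "\<dots> = 2 * log 2 L" using L_ge by (subst log_nat_power) auto
  finally have LL: "1 / 2 \<le> log 2 L" by simp
  have "r\<^sup>2 \<le> (sqrt (L / log 2 L))\<^sup>2" using r1 r2 unfolding L_def by (intro power_mono) auto
  also have "\<dots> = L / log 2 L" using L_ge LL by simp
  also have "\<dots> \<le> L / (1 / 2)" using L_ge LL by (intro divide_left_mono) auto
  finally show "r\<^sup>2 \<le> 2 * L" by simp
qed

lemma depth: "r\<^sup>2 \<le> depth r" "depth r \<le> 2 * r\<^sup>2" "1 \<le> depth r" "depth r \<le> 4 * n"
proof -
  show ge: "r\<^sup>2 \<le> depth r" unfolding depth_def by (rule real_nat_ceiling_ge)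
  show le: "depth r \<le> 2 * r\<^sup>2"
    unfolding depth_def using r_square(1) of_nat_ceiling[of "r\<^sup>2"] by linarith
  show "1 \<le> depth r" using ge r_square(1) by linarith
  have "real (depth r) \<le> real (4 * n)" using le r_square(2) L_le by simp
  then show "depth r \<le> 4 * n" by (simp only: of_nat_le_iff)
qed

lemma fanout: "n powr (1 / r\<^sup>2) \<le> fanout n r" "fanout n r \<le> 2 * n powr (1 / r\<^sup>2)" "1 \<le> n powr (1 / r\<^sup>2)"
proof -
  show "n powr (1 / r\<^sup>2) \<le> fanout n r" unfolding fanout_def by (rule real_nat_ceiling_ge)
  show "1 \<le> n powr (1 / r\<^sup>2)" using n by (intro ge_one_powr_ge_zero) auto
  then show "fanout n r \<le> 2 * n powr (1 / r\<^sup>2)" unfolding fanout_def by linarith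
qed

lemma height: "n \<le> fanout n r ^ depth r"
proof -
  have "real n = n powr (1 / r\<^sup>2 * r\<^sup>2)" using n r1 by simp
  also have "\<dots> \<le> n powr (1 / r\<^sup>2 * depth r)"
    using n depth(1) by (intro powr_mono mult_left_mono) auto
  also have "\<dots> = (n powr (1 / r\<^sup>2)) ^ depth r"
    unfolding powr_powr[symmetric] using n by (intro powr_realpow) simp
  also have "\<dots> \<le> real (fanout n r) ^ depth r" using fanout by (intro power_mono) auto
  finally have "real n \<le> real (fanout n r ^ depth r)" by simp
  then show ?thesis by (simp only: of_nat_le_iff)
qed

lemma message_length: "(2 * real c + 5) * L \<le> message_length c n" "message_length c n \<le> (2 * real c + 6) * L"
  "1 \<le> message_length c n"
proof -
  have pos: "0 \<le> (2 * real c + 6) * L" using L_ge by simp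
  show "message_length c n \<le> (2 * real c + 6) * L"
    unfolding message_length_def L_def[symmetric] using pos by (simp add: of_nat_floor)
  have "(2 * real c + 5) * L + 1 \<le> (2 * real c + 6) * L" using L_ge by (simp add: algebra_simps)
  then show ge: "(2 * real c + 5) * L \<le> message_length c n"
    unfolding message_length_def L_def[symmetric] by linarith
  have "1 * 1 \<le> (2 * real c + 5) * L" using L_ge by (intro mult_mono) auto
  with ge show "1 \<le> message_length c n" by linarith
qed

lemma card_edge_codes: "finite (edge_codes c n r)" "card (edge_codes c n r) \<le> 2 ^ message_length c n"
proof -
  let ?N = "n ^ c" and ?K = "4 * int (depth r) + 2 * int n"
  have fin: "finite {e. e \<subseteq> {..<?N} \<and> card e = 2}" by (rule finite_subset[of _ "Pow {..<?N}"]) auto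
  then show "finite (edge_codes c n r)" by (simp add: edge_codes_def)
  have "card {e. e \<subseteq> {..<?N} \<and> card e = 2} = ?N choose 2" by (subst n_subsets) auto
  also have "\<dots> \<le> ?N ^ 2"
    unfolding choose_two power2_eq_square by (rule order_trans[OF div_le_dividend]) simp
  finally have E: "card {e. e \<subseteq> {..<?N} \<and> card e = 2} \<le> ?N ^ 2" .
  \<comment> \<open>The exponents number at most \<open>2 * 18 * n + 1 \<le> 37 * n\<close>, using
    \<open>depth r \<le> 4 * n\<close>, and \<open>37 \<le> 3 ^ 4 \<le> n ^ 4\<close>.\<close>
  have "3 ^ 4 \<le> n ^ 4" using n by (intro power_mono) auto
  then have "37 * n \<le> n ^ 4 * n" by (intro mult_right_mono) auto
  moreover have "card {- ?K..?K} \<le> 37 * n" using depth(4) n by simp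
  ultimately have K: "card {- ?K..?K} \<le> n ^ 5" by (simp add: power_Suc2[symmetric])
  have "card (edge_codes c n r) \<le> ?N ^ 2 * n ^ 5"
    unfolding edge_codes_def card_cartesian_product using E K by (intro mult_le_mono)
  also have "\<dots> = n ^ (2 * c + 5)" by (simp add: power_mult[symmetric] power_add mult.commute)
  finally have "real (card (edge_codes c n r)) \<le> real n ^ (2 * c + 5)"
    by (metis of_nat_le_iff of_nat_power)
  also have "\<dots> = (2 powr L) powr (2 * c + 5)" using n by (simp add: L_def powr_realpow[symmetric])
  also have "\<dots> = 2 powr ((2 * real c + 5) * L)" by (simp add: powr_powr mult.commute)
  also have "\<dots> \<le> 2 powr message_length c n" using message_length(1) by (intro powr_mono) auto
  also have "\<dots> = real (2 ^ message_length c n)" by (simp add: powr_realpow)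
  finally show "card (edge_codes c n r) \<le> 2 ^ message_length c n" by (simp only: of_nat_le_iff)
qed

lemma encode: "inj_on (encode c n r) (edge_codes c n r)"
  "p \<in> edge_codes c n r \<Longrightarrow> length (encode c n r p) = message_length c n"
  using someI_ex[OF encoding_exists[OF card_edge_codes]] unfolding encode_def by blast+

sublocale encoding_protocol "fanout n r" "depth r" "message_length c n" "edge_codes c n r" "encode c n r"
proof
  show "0 < fanout n r" using fanout by (metis less_le_trans of_nat_0_less_iff zero_less_one order_trans)
  show "encode c n r p \<noteq> []" if "p \<in> edge_codes c n r" for p
    using encode(2)[OF that] message_length(3) by auto
qed (use encode message_length in auto)

text \<open>The factor 2 is absorbed into \<open>24 ^ depth r\<close>, at most
  \<open>24 powr (2 * r\<^sup>2) = 576 powr r\<^sup>2\<close>. The 16 is chosen so that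
  \<open>(3/2) ^ 16\<close> exceeds 576.\<close>

lemma approximation_factor: "2 * 12 ^ depth r \<le> L powr (16 * r\<^sup>2)" "3 ^ depth r \<le> L powr (16 * r\<^sup>2)"
  "1 \<le> L powr (16 * r\<^sup>2)"
proof -
  have "(2::real) ^ 1 \<le> 2 ^ depth r" using depth(3) by (intro power_increasing) auto
  then have "2 * 12 ^ depth r \<le> 2 ^ depth r * (12::real) ^ depth r" by (intro mult_right_mono) auto
  also have "\<dots> = 24 powr depth r" by (simp add: power_mult_distrib[symmetric] powr_realpow)
  also have "\<dots> \<le> 24 powr (2 * r\<^sup>2)" using depth(2) by (intro powr_mono) auto
  also have "\<dots> = 576 powr r\<^sup>2" by (simp add: powr_powr[symmetric])
  also have "\<dots> \<le> (L powr 16) powr r\<^sup>2"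
  proof (intro powr_mono2)
    have "576 \<le> (3 / 2 :: real) ^ 16" by (simp add: power_divide)
    also have "\<dots> \<le> L ^ 16" using L_ge by (intro power_mono) auto
    finally show "576 \<le> L powr 16" using L_ge powr_realpow[of L 16] by simp
  qed auto
  also have "\<dots> = L powr (16 * r\<^sup>2)" by (simp add: powr_powr)
  finally show 1: "2 * 12 ^ depth r \<le> L powr (16 * r\<^sup>2)" .
  have "(3::real) ^ depth r \<le> 12 ^ depth r" "(1::real) \<le> 12 ^ depth r" by (auto intro: power_mono)
  with 1 show "3 ^ depth r \<le> L powr (16 * r\<^sup>2)" "1 \<le> L powr (16 * r\<^sup>2)" by linarith+
qed

text \<open>At most \<open>5 * L\<close> phases of at most \<open>33 * x\<close> rounds, where
  \<open>x = n powr (1 / r\<^sup>2)\<close>, and the \<open>Start\<close> round, counted as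
  \<open>1 \<le> L * x\<close>: 5 * 33 + 1 = 166.\<close>

lemma period_length_le: "period_length \<le> 166 * L * n powr (1 / r\<^sup>2)"
proof -
  define x where "x = n powr (1 / r\<^sup>2)"
  have x: "1 \<le> x" "fanout n r \<le> 2 * x" using fanout by (auto simp: x_def)
  have "real (Suc (depth r)) \<le> 5 * L" using depth(2) r_square(2) L_ge by simp
  moreover have "real (16 * fanout n r + 1) \<le> 33 * x" using x by simp
  ultimately have "real (Suc (depth r)) * real (16 * fanout n r + 1) \<le> (5 * L) * (33 * x)"
    by (intro mult_mono) (use L_ge in auto)
  moreover have "1 \<le> L * x" using L_ge x(1) mult_mono[of 1 L 1 x] by simp
  ultimately show ?thesis
    unfolding period_length_def x_def[symmetric] by (simp add: algebra_simps)
qed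

end

text \<open>The least such \<open>m\<close> depends on the actual weights and is what the
  announcements detect; \<open>U\<close> only bounds it, through
  \<open>\<lfloor>log 2 U\<rfloor> + 1 \<le> 2 * log 2 U\<close>.\<close>

lemma number_of_classes:
  assumes "2 \<le> (U::nat)" "\<And>e. e \<in> E \<Longrightarrow> w e \<le> U"
  obtains m where "\<And>e. e \<in> E \<Longrightarrow> w e < (2::nat) ^ m" "real m \<le> 2 * log 2 U"
    "\<And>i. i < m \<Longrightarrow> \<exists>e\<in>E. 2 ^ i \<le> w e"
proof -
  obtain j where j: "2 ^ j \<le> U" "U < 2 ^ (j + 1)" using ex_power_ivl1[of 2 U] assms(1) by auto
  define m where "m = (LEAST m. \<forall>e\<in>E. w e < 2 ^ m)"
  have bound: "\<forall>e\<in>E. w e < 2 ^ (j + 1)" using assms(2) j(2) le_less_trans by blast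
  then have "\<forall>e\<in>E. w e < 2 ^ m" unfolding m_def by (rule LeastI)
  moreover have "m \<le> j + 1" unfolding m_def using bound by (rule Least_le)
  moreover have "real j \<le> log 2 U" using j(1) assms(1) by (intro le_log2_of_power) 
  moreover have "log 2 2 \<le> log 2 U" using assms(1) by (subst log_le_cancel_iff) auto
  moreover have "\<exists>e\<in>E. 2 ^ i \<le> w e" if "i < m" for i
    using not_less_Least[of i "\<lambda>m. \<forall>e\<in>E. w e < 2 ^ m"] that unfolding m_def by (auto simp: not_less)
  ultimately show thesis using that[of m] by simp
qed

theorem theorem3p3:
  fixes c :: nat
  shows "\<exists>(A :: (local_input, nat set set \<times> (nat set \<Rightarrow> real)) cc_algorithm)
      (B :: real) (C\<^sub>1 :: real) (C\<^sub>2 :: real) (C\<^sub>3 :: real) (C\<^sub>4 :: real).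
    0 < B \<and> 0 < C\<^sub>1 \<and> 0 < C\<^sub>2 \<and> 0 < C\<^sub>3 \<and> 0 < C\<^sub>4 \<and>
    (\<forall>(n :: nat) (U :: nat) (r :: real) (V :: nat set) (E :: nat set set) (w :: nat set \<Rightarrow> nat).
      3 \<le> n \<longrightarrow> 2 \<le> U \<longrightarrow>
      1 \<le> r \<longrightarrow> r \<le> sqrt (log 2 n / log 2 (log 2 n)) \<longrightarrow>
      simple_graph V E \<longrightarrow> card V = n \<longrightarrow> (\<forall>v\<in>V. v < n ^ c) \<longrightarrow>
      (\<forall>e\<in>E. w e \<in> {1..U}) \<longrightarrow>
      message_bits_le A V (initial_knowledge n r E w) (B * log 2 n) \<and>
      (\<exists>F wH.
        spectral_sparsifier (log 2 n powr (C\<^sub>1 * r\<^sup>2)) V E (\<lambda>e. real (w e)) F wH \<and>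
        real (card F) \<le> C\<^sub>2 * n * log 2 n * log 2 U \<and>
        all_output_within A V (initial_knowledge n r E w)
          (C\<^sub>3 * log 2 n * log 2 U * n powr (C\<^sub>4 / r\<^sup>2)) (F, wH)))"
proof (rule exI[of _ "algorithm c"], rule exI[of _ "2 * real c + 6"], rule exI[of _ 16],
    rule exI[of _ 16], rule exI[of _ 333], rule exI[of _ 1], intro conjI allI impI)
  \<comment> \<open>Origin of the witnesses: \<open>2 * c + 6\<close> is the factor in
    \<open>message_length\<close>, the first 16 the exponent in \<open>approximation_factor\<close>;
    the second 16 comes from \<open>8 * n\<close> edges in each of at most
    \<open>2 * log 2 U\<close> classes, and 333 = 2 * 166 + 1 counts their periods and the final
    round.\<close>
  fix n U :: nat and r :: real and V :: "nat set" and E :: "nat set set" and w :: "nat set \<Rightarrow> nat"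
  assume n: "3 \<le> n" and U: "2 \<le> U" and r: "1 \<le> r" "r \<le> sqrt (log 2 n / log 2 (log 2 n))"
    and G: "simple_graph V E" and card_V: "card V = n" and ids: "\<forall>v\<in>V. v < n ^ c"
    and w: "\<forall>e\<in>E. w e \<in> {1..U}"
  interpret parameters c n r "log 2 n" by unfold_locales (use n r in auto)
  define inps where "inps = initial_knowledge n r E w"
  have pub: "num_nodes (inps v) = n" "parameter (inps v) = r" for v
    by (simp_all add: inps_def initial_knowledge_def)
  have snd: "send (algorithm c) (inps v) h = send_message (inps v) h" for v h
    by (simp add: algorithm_def pub)
  have dec: "decide (algorithm c) (inps v) h = decision (inps v) h" for v h
    by (simp add: algorithm_def pub)
  have "length (send (algorithm c) (inps v) h u) \<le> message_length c n" for v h u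
    by (simp add: snd send_message_def clip_def)
  then have "real (length (send (algorithm c) (inps v) h u)) \<le> (2 * real c + 6) * log 2 n" for v h u
    using message_length(2) by (meson of_nat_mono order_trans)
  then show "message_bits_le (algorithm c) V (initial_knowledge n r E w) ((2 * real c + 6) * log 2 n)"
    unfolding message_bits_le_def inps_def by blast
  have V: "V \<noteq> {}" using card_V n by auto
  have codes: "(e, i) \<in> edge_codes c n r"
    if "e \<subseteq> V" "card e = 2" "\<bar>i\<bar> \<le> 4 * int (depth r) + 2 * int (card V)" for e i
    using that ids card_V by (auto simp: edge_codes_def)
  obtain m where m: "\<And>e. e \<in> E \<Longrightarrow> w e < 2 ^ m" "real m \<le> 2 * log 2 U"
    "\<And>i. i < m \<Longrightarrow> \<exists>e\<in>E. 2 ^ i \<le> w e"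
    using number_of_classes[of U E w] U w by auto
  obtain F wH where F: "F \<subseteq> E" "card F \<le> 8 * card V * m"
    and up: "\<And>x. quadratic_form V (laplacian F wH) x \<le> 3 ^ depth r * quadratic_form V (laplacian E w) x"
    and lo: "\<And>x. quadratic_form V (laplacian E w) x \<le> 2 * 12 ^ depth r * quadratic_form V (laplacian F wH) x"
    and out: "\<And>v. v \<in> V \<Longrightarrow> node_outputs (algorithm c) V inps (m * period_length + 1) v (F, wH)"
    using run_correct[of V "algorithm c" n r E w m] snd dec G V height card_V codes w m
    unfolding inps_def by auto
  let ?\<alpha> = "log 2 n powr (16 * r\<^sup>2)" and ?W = "log 2 U"
  have W: "1 \<le> ?W" using U by (subst le_log_iff) auto
  have H: "simple_graph V F" using G F(1) by (auto simp: simple_graph_def)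
  have qE: "0 \<le> quadratic_form V (laplacian E w) x" for x
    unfolding quadratic_form_laplacian[OF G] by (intro sum_nonneg) auto
  \<comment> \<open>Nonnegativity for \<open>wH\<close> is read off the lower bound, as
    \<open>run_correct\<close> states nothing about the signs of \<open>wH\<close>.\<close>
  have qF: "0 \<le> quadratic_form V (laplacian F wH) x" for x
    using order_trans[OF qE lo] by (simp add: zero_le_mult_iff power_le_zero_eq)
  have "spectral_sparsifier ?\<alpha> V E (\<lambda>e. real (w e)) F wH"
    unfolding spectral_sparsifier_def
  proof (intro conjI allI)
    show "1 \<le> ?\<alpha>" by (rule approximation_factor)
    fix x
    have "quadratic_form V (laplacian F wH) x \<le> ?\<alpha> * quadratic_form V (laplacian E w) x"
      by (rule order_trans[OF up mult_right_mono[OF approximation_factor(2) qE]])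
    then show "1 / ?\<alpha> * quadratic_form V (laplacian F wH) x \<le> quadratic_form V (laplacian E w) x"
      using approximation_factor(3) qE[of x] by (simp add: divide_le_eq mult.commute)
    show "quadratic_form V (laplacian E w) x \<le> ?\<alpha> * quadratic_form V (laplacian F wH) x"
      by (rule order_trans[OF lo mult_right_mono[OF approximation_factor(1) qF]])
  qed (rule F)
  moreover have "real (card F) \<le> 16 * real n * log 2 n * ?W"
  proof -
    have "real (card F) \<le> real (8 * card V * m)" using F(2) by (simp only: of_nat_le_iff)
    also have "\<dots> \<le> 8 * n * (2 * ?W)"
      unfolding card_V of_nat_mult using m(2) by (intro mult_left_mono) auto
    also have "\<dots> = 16 * real n * 1 * ?W" by simp
    also have "\<dots> \<le> 16 * real n * log 2 n * ?W"
      by (rule mult_right_mono[OF mult_left_mono]) (use L_ge W in auto)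
    finally show ?thesis .
  qed
  moreover have "all_output_within (algorithm c) V (initial_knowledge n r E w)
      (333 * log 2 n * ?W * n powr (1 / r\<^sup>2)) (F, wH)"
  proof -
    let ?x = "n powr (1 / r\<^sup>2)"
    have "real m * real period_length \<le> (2 * ?W) * (166 * log 2 n * ?x)"
      using m(2) period_length_le W by (intro mult_mono) auto
    moreover have "1 * 1 * 1 \<le> log 2 n * ?W * ?x"
      using L_ge W fanout(3) by (intro mult_mono) auto
    ultimately have "real (m * period_length + 1) \<le> 333 * log 2 n * ?W * ?x"
      by (simp add: algebra_simps)
    then show ?thesis using out unfolding all_output_within_def inps_def by blast
  qed
  ultimately show "\<exists>F wH.
        spectral_sparsifier ?\<alpha> V E (\<lambda>e. real (w e)) F wH \<and>
        real (card F) \<le> 16 * real n * log 2 n * ?W \<and>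
        all_output_within (algorithm c) V (initial_knowledge n r E w)
          (333 * log 2 n * ?W * n powr (1 / r\<^sup>2)) (F, wH)"
    by blast
qed simp_all

end
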